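(* Let $q>2$ be an integer and let $Q$ be an integer with $q\le Q\le Q(q)$, where $$Q(q)=\bigg[\frac{\big(2\sqrt{q-1}+1+\sqrt{4\sqrt{q-1}+1}\big)^2}{4}\bigg]+1$$ and $[t]$ denotes the integer part of $t$. Let $v_n$ be the Perron Frobenius eigenvector of $A_{Z_n}$, normalized by $v_n(0)=1$, where $Z_n$ is the graph obtained from $\mathbb G^Q$ by adding one self-loop at each vertex of the ball $\mathbb G^q_n\subset\mathbb G^q$ of radius $n$ centered at the root $0$. Then $v_n$ converges pointwise, as $n\to\infty$, to a weight $v$ which is a (generalized) Perron Frobenius eigenvector for $A_{\mathbb G^{Q,q}}$. It is given by $$v(x)=a(\lambda_* )^{d(x,\mathbb G^q)}\varphi_{1/2}(y(x)),\qquad x\in\mathbb G^Q,$$ where $y(x)$ is the unique vertex of $\mathbb G^q$ with $d(x,y(x))=d(x,\mathbb G^q)$; where $$a(\lambda)=\frac{1-\sqrt{1-\frac{4(Q-1)}{\lambda^2}}}{\frac{2(Q-1)}{\lambda}},\qquad \mu(\lambda)=\frac{Q-2+Q\sqrt{1-\frac{4(Q-1)}{\lambda^2}}}{\frac{2(Q-1)}{\lambda}};$$ where $\lambda_*=\|A_{\mathbb G^{Q,q}}\|$ is the unique solution in $\lambda>\|A_{\mathbb G^Q}\|=2\sqrt{Q-1}$ of $$\frac{1-a(\lambda)^2}{(1-a(\lambda)\sqrt{q-1})^2}=\mu(\lambda);$$ and where $\varphi_{1/2}$ is the function on $\mathbb G^q$ given by $$\varphi_{1/2}(x)=\Big(1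+\frac{q-2}{q}d(x,0)\Big)(q-1)^{-\frac{d(x,0)}{2}}.$$
   Context: For a graph $X$ (undirected, self-loops allowed) the adjacency operator $A_X$ acts on $\ell^2(VX)$ and its matrix entry $A_{xy}$ is the number of edges joining $x$ and $y$; a single self-loop at $x$ contributes $A_{xx}=1$. $\mathbb G^Q$ is the homogeneous Cayley tree of order $Q$ (the infinite tree in which every vertex has degree $Q$), with graph distance $d$. For $q\le Q$, $\mathbb G^{Q,q}$ is the graph obtained from $\mathbb G^Q$ by adding one self-loop at each vertex of a fixed subtree isomorphic to $\mathbb G^q$, denoted by $\mathbb G^q\subset\mathbb G^Q$ and containing the fixed root $0$. For a bounded operator $B$ on $\ell^2(VX)$ with nonnegative entries, a (generalized) Perron Frobenius eigenvector is a family $\{v(x)\}_{x\in VX}$ with positive entries, not necessarily in $\ell^2$, such that $\sum_{y}B_{xy}v(y)=\|B\|v(x)$ for all $x\in VX$. In the paper, $A_{Z_n}$ is stated to be recurrent (i.e. $\langle(\lambda\mathbf 1-A_{Z_n})^{-1}\delta_0,\delta_0\rangle\to+\infty$ as $\lambda\downarrow\|A_{Z_n}\|$), so that its Perron Frobenius eigenvector normalized by $v_n(0)=1$ is unique.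
   Formalization: The case where the number inside the integer part is an integer and Q = Q(q) (e.g. q=5, Q=17) is excluded: there the equation has no solution λ > 2√(Q−1). Existence and uniqueness of v_n are asserted for all large n, as uniqueness can fail for small n. *)

theory Defs
  imports "HOL-Analysis.Analysis"
begin

(* An undirected graph is given by its set E of edges: an edge joining x and y is the set {x, y},
   so a self-loop at x is the singleton {x}.  Vertices are all elements of the type, except
   where a vertex set is given explicitly. *)

definition walk :: "'a set set \<Rightarrow> 'a list \<Rightarrow> bool" where
  "walk E p \<longleftrightarrow> p \<noteq> [] \<and> successively (\<lambda>x y. {x, y} \<in> E) p"

definition graph_dist :: "'a set set \<Rightarrow> 'a \<Rightarrow> 'a \<Rightarrow> nat" where
  "graph_dist E x y = (LEAST n. \<exists>p. walk E p \<and> hd p = x \<and> last p = y \<and> length p = Suc n)"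

definition dist_to_set :: "'a set set \<Rightarrow> 'a \<Rightarrow> 'a set \<Rightarrow> nat" where
  "dist_to_set E x S = (INF y\<in>S. graph_dist E x y)"

definition nearest_vertex :: "'a set set \<Rightarrow> 'a set \<Rightarrow> 'a \<Rightarrow> 'a" where
  "nearest_vertex E S x = (THE y. y \<in> S \<and> graph_dist E x y = dist_to_set E x S)"

definition is_cycle :: "'a set set \<Rightarrow> 'a list \<Rightarrow> bool" where
  "is_cycle E p \<longleftrightarrow> length p \<ge> 3 \<and> distinct p \<and> walk E p \<and> {last p, hd p} \<in> E"

definition is_tree :: "'a set \<Rightarrow> 'a set set \<Rightarrow> bool" where
  "is_tree V E \<longleftrightarrow>
     V \<noteq> {} \<and>
     (\<forall>e\<in>E. e \<subseteq> V \<and> card e = 2) \<and>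
     (\<forall>x\<in>V. \<forall>y\<in>V. \<exists>p. walk E p \<and> hd p = x \<and> last p = y) \<and>
     (\<nexists>p. is_cycle E p)"

definition homogeneous_tree :: "nat \<Rightarrow> 'a set \<Rightarrow> 'a set set \<Rightarrow> bool" where
  "homogeneous_tree k V E \<longleftrightarrow>
     is_tree V E \<and> infinite V \<and>
     (\<forall>x\<in>V. finite {y. {x, y} \<in> E} \<and> card {y. {x, y} \<in> E} = k)"

definition add_loops :: "'a set set \<Rightarrow> 'a set \<Rightarrow> 'a set set" where
  "add_loops E T = E \<union> (\<lambda>x. {x}) ` T"

definition adjacency :: "'a set set \<Rightarrow> 'a \<Rightarrow> 'a \<Rightarrow> real" where
  "adjacency E x y = real (card {e \<in> E. e = {x, y}})"

(* Operators on the complex Hilbert space l^2 of the vertex set are given by their matrices. *)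

definition ell2 :: "('a \<Rightarrow> complex) set" where
  "ell2 = {f. (\<lambda>x. (cmod (f x))\<^sup>2) summable_on UNIV}"

definition ell2_norm :: "('a \<Rightarrow> complex) \<Rightarrow> real" where
  "ell2_norm f = sqrt (\<Sum>\<^sub>\<infinity>x. (cmod (f x))\<^sup>2)"

definition mat_apply :: "('a \<Rightarrow> 'a \<Rightarrow> real) \<Rightarrow> ('a \<Rightarrow> complex) \<Rightarrow> 'a \<Rightarrow> complex" where
  "mat_apply B f x = (\<Sum>\<^sub>\<infinity>y. of_real (B x y) * f y)"

definition bounded_operator :: "('a \<Rightarrow> 'a \<Rightarrow> real) \<Rightarrow> bool" where
  "bounded_operator B \<longleftrightarrow>
     (\<forall>f\<in>ell2. (\<forall>x. (\<lambda>y. of_real (B x y) * f y) summable_on UNIV) \<and> mat_apply B f \<in> ell2) \<and>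
     (\<exists>C. \<forall>f\<in>ell2. ell2_norm (mat_apply B f) \<le> C * ell2_norm f)"

(* Meaningful only under bounded_operator B, since the supremum is a real one. *)
definition operator_norm :: "('a \<Rightarrow> 'a \<Rightarrow> real) \<Rightarrow> real" where
  "operator_norm B = (SUP f\<in>{f \<in> ell2. ell2_norm f \<le> 1}. ell2_norm (mat_apply B f))"

(* Generalized eigenvector: v need not be square-summable. *)
definition perron_frobenius :: "('a \<Rightarrow> 'a \<Rightarrow> real) \<Rightarrow> ('a \<Rightarrow> real) \<Rightarrow> bool" where
  "perron_frobenius B v \<longleftrightarrow>
     bounded_operator B \<and> (\<forall>x y. B x y \<ge> 0) \<and> (\<forall>x. v x > 0) \<and>
     (\<forall>x. ((\<lambda>y. B x y * v y) has_sum (operator_norm B * v x)) UNIV)"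

definition ball_loops :: "'a set set \<Rightarrow> 'a set \<Rightarrow> 'a \<Rightarrow> nat \<Rightarrow> 'a set set" where
  "ball_loops E S r n = add_loops E {x \<in> S. graph_dist E x r \<le> n}"

(* The upper bound on Q is Q(q) = [Q_crit q] + 1.  When Q_crit q is itself an integer
   (q = 5 gives Q_crit q = 16), the value Q = Q_crit q + 1 is borderline: there the norm of the
   perturbed tree drops to 2 sqrt (Q - 1), and the secular equation has no solution above it. *)
definition Q_crit :: "nat \<Rightarrow> real" where
  "Q_crit q = (2 * sqrt (real q - 1) + 1 + sqrt (4 * sqrt (real q - 1) + 1))\<^sup>2 / 4"

definition decay_a :: "nat \<Rightarrow> real \<Rightarrow> real" where
  "decay_a Q l = (1 - sqrt (1 - 4 * (real Q - 1) / l\<^sup>2)) / (2 * (real Q - 1) / l)"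

definition secular_mu :: "nat \<Rightarrow> real \<Rightarrow> real" where
  "secular_mu Q l =
     (real Q - 2 + real Q * sqrt (1 - 4 * (real Q - 1) / l\<^sup>2)) / (2 * (real Q - 1) / l)"

definition secular_eq :: "nat \<Rightarrow> nat \<Rightarrow> real \<Rightarrow> bool" where
  "secular_eq Q q l \<longleftrightarrow>
     (1 - (decay_a Q l)\<^sup>2) / (1 - decay_a Q l * sqrt (real q - 1))\<^sup>2 = secular_mu Q l"

definition phi_half :: "nat \<Rightarrow> 'a set set \<Rightarrow> 'a \<Rightarrow> 'a \<Rightarrow> real" where
  "phi_half q E r x =
     (1 + (real q - 2) / real q * real (graph_dist E x r)) *
     (real q - 1) powr (- (real (graph_dist E x r) / 2))"

end

theory Submission
  imports Defs
begin

text \<open>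
  Write \<open>s = sqrt (q - 1)\<close> and \<open>\<lambda> = 1 / a + (Q - 1) * a\<close> with \<open>0 < a < 1 / sqrt (Q - 1)\<close>. A function
  \<open>a ^ d(x, S) * f (d(y(x), r))\<close> is an eigenfunction for \<open>\<lambda>\<close> off \<open>S\<close>, and on \<open>S\<close> the eigenvalue equation
  becomes a three-term recurrence for \<open>f\<close>. Where \<open>S\<close> carries loops, \<open>f\<close> is the spherical function of
  the \<open>q\<close>-regular tree with eigenvalue \<open>1 / a + (q - 1) * a - 1\<close>. This is the critical value \<open>2 * s\<close>
  exactly when \<open>(1 - s * a)\<^sup>2 = a\<close>, which is the secular equation. Where \<open>S\<close> carries no loops, \<open>f\<close>
  may decay geometrically with ratio \<open>a\<close>. For \<open>a\<close> slightly above the critical value the spherical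
  function oscillates, so for large \<open>n\<close> some such \<open>a\<close> matches the two regimes at radius \<open>n\<close>. This
  gives a positive square-summable eigenvector of the graph with loops on the ball of radius \<open>n\<close>,
  whose eigenvalue is therefore the norm. As \<open>n\<close> grows, \<open>a\<close> tends to the critical value, which gives
  the convergence and the lower bound for the norm of the limit; the Schur test gives the upper
  bound. Uniqueness among all positive eigenvectors with the same eigenvalue follows from the Schur
  bound applied to the positive part of a difference.
\<close>

section \<open>Symmetric nonnegative matrices and the Schur test\<close>

lemma of_real_ell2_iff: "(\<lambda>x. complex_of_real (u x)) \<in> ell2 \<longleftrightarrow> (\<lambda>x. (u x)\<^sup>2) summable_on UNIV"
  by (simp add: ell2_def)

lemma ell2_norm_of_real: "ell2_norm (\<lambda>x. complex_of_real (u x)) = sqrt (\<Sum>\<^sub>\<infinity>x. (u x)\<^sup>2)"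
  by (simp add: ell2_norm_def)

locale symmetric_matrix =
  fixes B :: "'a \<Rightarrow> 'a \<Rightarrow> real"
  assumes nonneg: "B x y \<ge> 0"
    and sym: "B x y = B y x"
    and fin: "finite {y. B x y \<noteq> 0}"
begin

text \<open>Rows are finite, so this sum is meaningful for every real function, including
  generalized eigenvectors outside \<open>ell2\<close>.\<close>

definition act :: "('a \<Rightarrow> real) \<Rightarrow> 'a \<Rightarrow> real" where
  "act u x = (\<Sum>y | B x y \<noteq> 0. B x y * u y)"

lemma act_has_sum: "((\<lambda>y. B x y * u y) has_sum act u x) UNIV"
  unfolding act_def
  by (rule has_sum_finite_neutralI) (use fin in auto)

lemma act_eqI: "((\<lambda>y. B x y * u y) has_sum t) UNIV \<Longrightarrow> act u x = t"
  using act_has_sum has_sum_unique by blast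

lemma act_mono: "(\<And>y. u y \<le> w y) \<Longrightarrow> act u x \<le> act w x"
  unfolding act_def by (intro sum_mono mult_left_mono) (auto simp: nonneg)

lemma act_diff: "act (\<lambda>y. u y - w y) x = act u x - act w x"
  unfolding act_def by (simp add: right_diff_distrib sum_subtractf)

lemma act_nonneg: "(\<And>y. u y \<ge> 0) \<Longrightarrow> act u x \<ge> 0"
  unfolding act_def by (intro sum_nonneg mult_nonneg_nonneg) (auto simp: nonneg)

lemma mat_has_sum:
  "((\<lambda>y. of_real (B x y) * f y) has_sum (\<Sum>y | B x y \<noteq> 0. of_real (B x y) * (f y :: complex))) UNIV"
  by (rule has_sum_finite_neutralI) (use fin in auto)

lemma mat_apply_eq: "mat_apply B f x = (\<Sum>y | B x y \<noteq> 0. of_real (B x y) * f y)"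
  unfolding mat_apply_def using mat_has_sum infsumI by blast

lemma mat_apply_of_real: "mat_apply B (\<lambda>y. of_real (u y)) = (\<lambda>x. of_real (act u x))"
  by (simp add: fun_eq_iff mat_apply_eq act_def)

text \<open>Cauchy-Schwarz after splitting each term as \<open>sqrt (B x y * v y)\<close> times
  \<open>sqrt (B x y / v y) * cmod (f y)\<close>: the row half of the Schur test.\<close>

lemma row_weighted_Cauchy_Schwarz:
  fixes f :: "'a \<Rightarrow> complex"
  assumes v: "\<And>x. v x > 0"
  shows "(cmod (mat_apply B f x))\<^sup>2 \<le>
    act v x * (\<Sum>y | B x y \<noteq> 0. B x y * (cmod (f y))\<^sup>2 / v y)"
proof -
  have "cmod (mat_apply B f x) \<le> (\<Sum>y | B x y \<noteq> 0. B x y * cmod (f y))"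
    unfolding mat_apply_eq
    by (rule order_trans[OF norm_sum]) (simp add: norm_mult nonneg)
  also have "\<dots> = (\<Sum>y | B x y \<noteq> 0. sqrt (B x y * v y) * (sqrt (B x y / v y) * cmod (f y)))"
  proof (rule sum.cong)
    fix y
    have "B x y * cmod (f y) = sqrt ((B x y)\<^sup>2) * cmod (f y)"
      by (simp add: nonneg)
    also have "(B x y)\<^sup>2 = (B x y * v y) * (B x y / v y)"
      using v[of y] by (simp add: power2_eq_square)
    finally show "B x y * cmod (f y) = sqrt (B x y * v y) * (sqrt (B x y / v y) * cmod (f y))"
      by (simp only: real_sqrt_mult mult.assoc)
  qed simp
  finally have "(cmod (mat_apply B f x))\<^sup>2 \<le>
      (\<Sum>y | B x y \<noteq> 0. sqrt (B x y * v y) * (sqrt (B x y / v y) * cmod (f y)))\<^sup>2"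
    by (rule power_mono) simp
  also have "\<dots> \<le> (\<Sum>y | B x y \<noteq> 0. (sqrt (B x y * v y))\<^sup>2) *
      (\<Sum>y | B x y \<noteq> 0. (sqrt (B x y / v y) * cmod (f y))\<^sup>2)"
    by (rule Cauchy_Schwarz_ineq_sum)
  also have "(\<Sum>y | B x y \<noteq> 0. (sqrt (B x y * v y))\<^sup>2) = act v x"
    unfolding act_def using v by (intro sum.cong) (auto simp: nonneg less_imp_le)
  also have "(\<Sum>y | B x y \<noteq> 0. (sqrt (B x y / v y) * cmod (f y))\<^sup>2) =
      (\<Sum>y | B x y \<noteq> 0. B x y * (cmod (f y))\<^sup>2 / v y)"
    using v by (intro sum.cong) (auto simp: nonneg less_imp_le power_mult_distrib)
  finally show ?thesis .
qed

lemma supersolution_nonneg: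
  assumes "\<And>x. v x > 0" "\<And>x. act v x \<le> l * v x"
  shows "l \<ge> 0"
proof -
  have "0 \<le> act v undefined" using assms(1) by (intro act_nonneg) (simp add: less_imp_le)
  also have "\<dots> \<le> l * v undefined" by (rule assms)
  finally show ?thesis using assms(1)[of undefined] by (simp add: zero_le_mult_iff not_less)
qed

text \<open>Summing the row estimate and exchanging sums leaves weighted column sums, which symmetry
  bounds by the same supersolution \<open>v\<close>.\<close>

lemma Schur_finite:
  fixes f :: "'a \<Rightarrow> complex"
  assumes v: "\<And>x. v x > 0" and sup: "\<And>x. act v x \<le> l * v x" and f: "f \<in> ell2" and X: "finite X"
  shows "(\<Sum>x\<in>X. (cmod (mat_apply B f x))\<^sup>2) \<le> l\<^sup>2 * (\<Sum>\<^sub>\<infinity>x. (cmod (f x))\<^sup>2)"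
proof -
  \<comment> \<open>\<open>Y\<close> collects every column met by a row in \<open>X\<close>, so both
    sums range over fixed finite sets and can be exchanged.\<close>
  define Y where "Y = (\<Union>x\<in>X. {y. B x y \<noteq> 0})"
  have Y: "finite Y" using X fin by (auto simp: Y_def)
  have l: "l \<ge> 0" by (rule supersolution_nonneg[OF v sup])
  have col: "(\<Sum>x\<in>X. B x y * v x) \<le> l * v y" for y
  proof -
    have "(\<Sum>x\<in>X. B x y * v x) = (\<Sum>x\<in>X. B y x * v x)" by (simp add: sym)
    also have "\<dots> = (\<Sum>x\<in>X \<inter> {x. B y x \<noteq> 0}. B y x * v x)"
      using X by (intro sum.mono_neutral_right) auto
    also have "\<dots> \<le> act v y"
      unfolding act_def using fin v
      by (intro sum_mono2 mult_nonneg_nonneg) (auto simp: nonneg less_imp_le)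
    finally show ?thesis using sup[of y] by simp
  qed
  have "(\<Sum>x\<in>X. (cmod (mat_apply B f x))\<^sup>2) \<le>
      (\<Sum>x\<in>X. (l * v x) * (\<Sum>y\<in>Y. B x y * (cmod (f y))\<^sup>2 / v y))"
  proof (rule sum_mono)
    fix x assume x: "x \<in> X"
    have "(cmod (mat_apply B f x))\<^sup>2 \<le>
        act v x * (\<Sum>y | B x y \<noteq> 0. B x y * (cmod (f y))\<^sup>2 / v y)"
      using v by (rule row_weighted_Cauchy_Schwarz)
    also have "(\<Sum>y | B x y \<noteq> 0. B x y * (cmod (f y))\<^sup>2 / v y) =
        (\<Sum>y\<in>Y. B x y * (cmod (f y))\<^sup>2 / v y)"
      using x Y by (intro sum.mono_neutral_left) (auto simp: Y_def)
    also have "act v x * \<dots> \<le> (l * v x) * \<dots>"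
      using sup v by (intro mult_right_mono sum_nonneg) (auto simp: nonneg less_imp_le)
    finally show "(cmod (mat_apply B f x))\<^sup>2 \<le>
      (l * v x) * (\<Sum>y\<in>Y. B x y * (cmod (f y))\<^sup>2 / v y)" .
  qed
  also have "\<dots> = (\<Sum>y\<in>Y. l * ((cmod (f y))\<^sup>2 / v y) * (\<Sum>x\<in>X. B x y * v x))"
    unfolding sum_distrib_left by (subst sum.swap) (simp add: mult_ac)
  also have "\<dots> \<le> (\<Sum>y\<in>Y. l * ((cmod (f y))\<^sup>2 / v y) * (l * v y))"
    using l v col by (intro sum_mono mult_left_mono) (auto simp: less_imp_le)
  also have "\<dots> = l\<^sup>2 * (\<Sum>y\<in>Y. (cmod (f y))\<^sup>2)"
    unfolding sum_distrib_left using v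
    by (intro sum.cong) (auto simp: power2_eq_square less_imp_neq[symmetric])
  also have "\<dots> \<le> l\<^sup>2 * (\<Sum>\<^sub>\<infinity>x. (cmod (f x))\<^sup>2)"
    using f Y by (intro mult_left_mono finite_sum_le_infsum) (auto simp: ell2_def)
  finally show ?thesis .
qed

lemma Schur_ell2:
  assumes "\<And>x. v x > 0" "\<And>x. act v x \<le> l * v x" "f \<in> ell2"
  shows "mat_apply B f \<in> ell2"
  unfolding ell2_def
  using Schur_finite[OF assms]
  by (auto intro!: nonneg_bdd_above_summable_on bdd_aboveI2)

lemma Schur_infsum:
  assumes "\<And>x. v x > 0" "\<And>x. act v x \<le> l * v x" "f \<in> ell2"
  shows "(\<Sum>\<^sub>\<infinity>x. (cmod (mat_apply B f x))\<^sup>2) \<le> l\<^sup>2 * (\<Sum>\<^sub>\<infinity>x. (cmod (f x))\<^sup>2)"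
  using Schur_ell2[OF assms] Schur_finite[OF assms]
  by (intro infsum_le_finite_sums) (auto simp: ell2_def)

lemma Schur_norm:
  assumes "\<And>x. v x > 0" "\<And>x. act v x \<le> l * v x" "f \<in> ell2"
  shows "ell2_norm (mat_apply B f) \<le> l * ell2_norm f"
proof -
  have "ell2_norm (mat_apply B f) \<le> sqrt (l\<^sup>2 * (\<Sum>\<^sub>\<infinity>x. (cmod (f x))\<^sup>2))"
    unfolding ell2_norm_def using Schur_infsum[OF assms] by simp
  also have "\<dots> = l * ell2_norm f"
    using supersolution_nonneg[OF assms(1,2)] by (simp add: ell2_norm_def real_sqrt_mult)
  finally show ?thesis .
qed

lemma Schur_bounded:
  assumes "\<And>x. v x > 0" "\<And>x. act v x \<le> l * v x"
  shows "bounded_operator B"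
  unfolding bounded_operator_def
  using Schur_norm[OF assms] Schur_ell2[OF assms] has_sum_imp_summable[OF mat_has_sum]
  by blast

lemma Schur_operator_norm_le:
  assumes "\<And>x. v x > 0" "\<And>x. act v x \<le> l * v x"
  shows "operator_norm B \<le> l"
  unfolding operator_norm_def
proof (rule cSUP_least)
  show "{f \<in> ell2. ell2_norm f \<le> 1} \<noteq> {}"
    by (auto simp: ell2_def ell2_norm_def intro!: exI[of _ "\<lambda>_. 0"])
next
  fix f :: "'a \<Rightarrow> complex" assume "f \<in> {f \<in> ell2. ell2_norm f \<le> 1}"
  then have f: "f \<in> ell2" "ell2_norm f \<le> 1" by auto
  have "ell2_norm (mat_apply B f) \<le> l * ell2_norm f" by (rule Schur_norm[OF assms f(1)])
  also have "\<dots> \<le> l * 1"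
    using f(2) supersolution_nonneg[OF assms] by (intro mult_left_mono) auto
  finally show "ell2_norm (mat_apply B f) \<le> l" by simp
qed

text \<open>A nonnegative square-summable subsolution, normalized, is a test vector whose image
  dominates \<open>t\<close> times itself. Boundedness is what makes the real supremum in
  \<open>operator_norm\<close> an upper bound.\<close>

lemma operator_norm_ge:
  assumes bdd: "bounded_operator B" and t: "t \<ge> 0"
    and u: "\<And>x. u x \<ge> 0" "(\<lambda>x. (u x)\<^sup>2) summable_on UNIV" "u z \<noteq> 0"
    and sub: "\<And>x. act u x \<ge> t * u x"
  shows "operator_norm B \<ge> t"
proof -
  obtain C where C: "\<And>f. f \<in> ell2 \<Longrightarrow> ell2_norm (mat_apply B f) \<le> C * ell2_norm f"
    using bdd unfolding bounded_operator_def by blast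
  define s where "s = sqrt (\<Sum>\<^sub>\<infinity>x. (u x)\<^sup>2)"
  have "0 < (u z)\<^sup>2" using u(3) by simp
  also have "(u z)\<^sup>2 \<le> (\<Sum>\<^sub>\<infinity>x. (u x)\<^sup>2)"
    using finite_sum_le_infsum[of "\<lambda>x. (u x)\<^sup>2" UNIV "{z}"] u(2) by simp
  finally have s: "s > 0" unfolding s_def by simp
  define w where "w = (\<lambda>x. u x / s)"
  have sum_w: "(\<lambda>x. (w x)\<^sup>2) summable_on UNIV"
    using summable_on_cmult_left[OF u(2), of "inverse (s\<^sup>2)"]
    by (simp add: w_def power_divide divide_inverse power_mult_distrib power_inverse)
  have s2: "(\<Sum>\<^sub>\<infinity>x. (u x)\<^sup>2) = s\<^sup>2"
    unfolding s_def by (simp add: infsum_nonneg)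
  have norm_w: "(\<Sum>\<^sub>\<infinity>x. (w x)\<^sup>2) = 1"
    using infsum_cmult_left[of "inverse (s\<^sup>2)" "\<lambda>x. (u x)\<^sup>2" UNIV] u(2) s s2
    by (simp add: w_def power_divide divide_inverse power_mult_distrib power_inverse)
  have w_in: "(\<lambda>x. complex_of_real (w x)) \<in> ell2" by (simp add: of_real_ell2_iff sum_w)
  have act_w: "t * w x \<le> act w x" for x
  proof -
    have "act w x = act u x / s" by (simp add: act_def w_def sum_divide_distrib)
    then show ?thesis using sub[of x] s by (simp add: w_def divide_right_mono)
  qed
  have "mat_apply B (\<lambda>x. of_real (w x)) \<in> ell2"
    using bdd w_in unfolding bounded_operator_def by blast
  then have sum_act: "(\<lambda>x. (act w x)\<^sup>2) summable_on UNIV"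
    by (simp add: mat_apply_of_real of_real_ell2_iff)
  have "t\<^sup>2 = (\<Sum>\<^sub>\<infinity>x. t\<^sup>2 * (w x)\<^sup>2)"
    using norm_w infsum_cmult_right[of "t\<^sup>2" "\<lambda>x. (w x)\<^sup>2" UNIV] sum_w by simp
  also have "\<dots> \<le> (\<Sum>\<^sub>\<infinity>x. (act w x)\<^sup>2)"
  proof (rule infsum_mono)
    show "(\<lambda>x. t\<^sup>2 * (w x)\<^sup>2) summable_on UNIV" by (intro summable_on_cmult_right sum_w)
    show "t\<^sup>2 * (w x)\<^sup>2 \<le> (act w x)\<^sup>2" for x
      unfolding power_mult_distrib[symmetric]
      using t u(1)[of x] s by (intro power_mono[OF act_w]) (simp add: w_def)
  qed (rule sum_act)
  finally have "t \<le> sqrt (\<Sum>\<^sub>\<infinity>x. (act w x)\<^sup>2)" using t real_le_rsqrt by blast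
  also have "\<dots> = ell2_norm (mat_apply B (\<lambda>x. of_real (w x)))"
    by (simp add: mat_apply_of_real ell2_norm_of_real)
  also have "\<dots> \<le> operator_norm B"
    unfolding operator_norm_def
  proof (rule cSUP_upper)
    show "(\<lambda>x. complex_of_real (w x)) \<in> {f \<in> ell2. ell2_norm f \<le> 1}"
      using w_in by (simp add: ell2_norm_of_real norm_w)
    have "ell2_norm (mat_apply B f) \<le> \<bar>C\<bar>" if "f \<in> ell2" "ell2_norm f \<le> 1" for f
    proof -
      have "0 \<le> ell2_norm f" by (simp add: ell2_norm_def infsum_nonneg)
      then have "C * ell2_norm f \<le> \<bar>C\<bar> * 1" using that(2) by (intro mult_mono) auto
      then show ?thesis using C[OF that(1)] by simp
    qed
    then show "bdd_above ((\<lambda>f. ell2_norm (mat_apply B f)) ` {f \<in> ell2. ell2_norm f \<le> 1})"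
      by (intro bdd_aboveI2) auto
  qed
  finally show ?thesis .
qed

text \<open>At a zero of \<open>h\<close> the row sum vanishes and has nonnegative terms, so
  \<open>h\<close> is zero at every neighbour; irreducibility reaches all vertices.\<close>

lemma zero_propagates:
  assumes irr: "\<And>x y. (\<lambda>x y. B x y > 0)\<^sup>*\<^sup>* x y"
    and h: "\<And>x. h x \<ge> 0" "\<And>x. act h x = l * h x" "h z = 0"
  shows "h x = 0"
  using irr[of z x]
proof induction
  case (step x y)
  have "(\<Sum>y | B x y \<noteq> 0. B x y * h y) = 0"
    using h(2)[of x] step.IH by (simp add: act_def)
  moreover have "0 \<le> B x y * h y" for y using h(1) nonneg by simp
  ultimately have "\<forall>y\<in>{y. B x y \<noteq> 0}. B x y * h y = 0"
    using fin by (subst (asm) sum_nonneg_eq_0_iff) auto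
  then show ?case using step.hyps(2) by auto
qed (rule h(3))

text \<open>The negative part \<open>h\<close> of \<open>u - w\<close> satisfies \<open>act h \<ge> l * h\<close> and is square-summable,
  so the Schur bound forces equality.\<close>

lemma positive_eigenvector_unique:
  assumes irr: "\<And>x y. (\<lambda>x y. B x y > 0)\<^sup>*\<^sup>* x y"
    and w: "\<And>x. w x > 0" "\<And>x. act w x = l * w x" "(\<lambda>x. (w x)\<^sup>2) summable_on UNIV"
    and u: "\<And>x. u x > 0" "\<And>x. act u x = l * u x"
    and eq: "u z = w z"
  shows "u = w"
proof -
  define h where "h = (\<lambda>x. max (w x - u x) 0)"
  have l: "l \<ge> 0" using supersolution_nonneg[of w l] w by simp
  have h0: "h x \<ge> 0" for x by (simp add: h_def)
  have sum_h: "(\<lambda>x. (h x)\<^sup>2) summable_on UNIV"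
  proof (rule summable_on_comparison_test[OF w(3)])
    show "(h x)\<^sup>2 \<le> (w x)\<^sup>2" for x
      using u(1)[of x] w(1)[of x] by (intro power_mono) (auto simp: h_def)
  qed simp
  have h_in: "(\<lambda>x. complex_of_real (h x)) \<in> ell2" by (simp add: of_real_ell2_iff sum_h)
  have ge: "act h x \<ge> l * h x" for x
  proof (cases "w x \<le> u x")
    case True
    then show ?thesis using act_nonneg[of h x] h0 by (simp add: h_def)
  next
    case False
    have "l * h x = act (\<lambda>y. w y - u y) x"
      using False by (simp add: act_diff w(2) u(2) h_def algebra_simps)
    also have "\<dots> \<le> act h x" by (rule act_mono) (simp add: h_def)
    finally show ?thesis .
  qed
  have act_le: "act w x \<le> l * w x" for x by (simp add: w(2))
  have le: "(\<Sum>\<^sub>\<infinity>x. (act h x)\<^sup>2) \<le> l\<^sup>2 * (\<Sum>\<^sub>\<infinity>x. (h x)\<^sup>2)"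
    using Schur_infsum[OF w(1) act_le h_in] by (simp add: mat_apply_of_real)
  have sum_act: "(\<lambda>x. (act h x)\<^sup>2) summable_on UNIV"
    using Schur_ell2[OF w(1) act_le h_in] by (simp add: mat_apply_of_real of_real_ell2_iff)
  have sum_lh: "(\<lambda>x. - l\<^sup>2 * (h x)\<^sup>2) summable_on UNIV"
    by (intro summable_on_cmult_right sum_h)
  \<comment> \<open>\<open>g\<close> is pointwise nonnegative by \<open>ge\<close>, while the Schur
    bound makes its total nonpositive, so it vanishes identically.\<close>
  define g where "g = (\<lambda>x. (act h x)\<^sup>2 + (- l\<^sup>2) * (h x)\<^sup>2)"
  have g0: "g x \<ge> 0" for x
    using power_mono[OF ge[of x], of 2] l h0[of x] by (simp add: g_def power_mult_distrib)
  have sum_g: "g summable_on UNIV" unfolding g_def by (rule summable_on_add[OF sum_act sum_lh])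
  have "(\<Sum>\<^sub>\<infinity>x. g x) \<le> 0"
    unfolding g_def infsum_add[OF sum_act sum_lh]
    by (subst infsum_cmult_right) (use le sum_h in auto)
  then have "g x = 0" for x
    using nonneg_infsum_le_0D[of g UNIV x] g0 sum_g by simp
  then have "(act h x)\<^sup>2 = (l * h x)\<^sup>2" for x by (simp add: g_def power_mult_distrib)
  then have "act h x = l * h x" for x
    using act_nonneg[of h x] h0 l by (metis mult_nonneg_nonneg power2_eq_imp_eq)
  then have "h x = 0" for x
    by (rule zero_propagates[where z = z, OF irr h0]) (simp_all add: h_def eq)
  then have "max (w x - u x) 0 = 0" for x by (simp add: h_def)
  then have le': "w x \<le> u x" for x by (metis max.cobounded1 diff_le_0_iff_le)
  \<comment> \<open>With \<open>w\<close> below \<open>u\<close>, the difference is itself a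
    nonnegative eigenfunction vanishing at \<open>z\<close>.\<close>
  have "u x - w x = 0" for x
  proof (rule zero_propagates[where z = z, OF irr])
    show "act (\<lambda>x. u x - w x) x = l * (u x - w x)" for x
      by (simp add: act_diff w(2) u(2) algebra_simps)
  qed (use le' eq in auto)
  then show ?thesis by (simp add: fun_eq_iff)
qed

text \<open>The same \<open>w\<close> serves as Schur weight for the upper bound and as test vector
  for the lower bound.\<close>

lemma eigenvector_operator_norm:
  assumes "\<And>x. w x > 0" "\<And>x. act w x = l * w x" "(\<lambda>x. (w x)\<^sup>2) summable_on UNIV"
  shows "operator_norm B = l"
proof (rule antisym)
  show "operator_norm B \<le> l" by (rule Schur_operator_norm_le[of w]) (simp_all add: assms)
  have "bounded_operator B" by (rule Schur_bounded[of w l]) (simp_all add: assms)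
  then show "l \<le> operator_norm B"
    using assms supersolution_nonneg[of w l]
    by (intro operator_norm_ge[of l w undefined]) (auto simp: less_imp_le less_imp_neq[symmetric])
qed

lemma perron_frobenius_iff:
  assumes "bounded_operator B"
  shows "perron_frobenius B v \<longleftrightarrow> (\<forall>x. v x > 0) \<and> (\<forall>x. act v x = operator_norm B * v x)"
  unfolding perron_frobenius_def using assms nonneg act_has_sum act_eqI by metis

end

section \<open>Trees\<close>

text \<open>Relation powers are easier to split and to induct on than the lists of
  \<open>walk\<close>; distances are handled through them from here on.\<close>

lemma walk_relpowp:
  "(\<exists>p. walk E p \<and> hd p = x \<and> last p = y \<and> length p = Suc n) \<longleftrightarrow> ((\<lambda>a b. {a, b} \<in> E) ^^ n) x y"
proof (induction n arbitrary: x)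
  case 0
  have "walk E p \<and> hd p = x \<and> last p = y \<and> length p = Suc 0 \<longleftrightarrow> p = [x] \<and> x = y" for p
    by (cases p) (auto simp: walk_def)
  then show ?case by simp
next
  case (Suc n)
  show ?case
  proof
    assume "\<exists>p. walk E p \<and> hd p = x \<and> last p = y \<and> length p = Suc (Suc n)"
    then obtain p where p: "walk E p" "hd p = x" "last p = y" "length p = Suc (Suc n)" by blast
    then obtain p' where p': "p = x # p'" "length p' = Suc n" by (cases p) auto
    then have "p' \<noteq> []" by auto
    then have "walk E p' \<and> hd p' = hd p' \<and> last p' = y \<and> length p' = Suc n" "{x, hd p'} \<in> E"
      using p p' by (auto simp: walk_def successively_Cons)
    then show "((\<lambda>a b. {a, b} \<in> E) ^^ Suc n) x y"
      using Suc.IH[of "hd p'"] by (blast intro: relpowp_Suc_I2)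
  next
    assume "((\<lambda>a b. {a, b} \<in> E) ^^ Suc n) x y"
    then obtain z where z: "{x, z} \<in> E" "((\<lambda>a b. {a, b} \<in> E) ^^ n) z y"
      by (blast dest: relpowp_Suc_D2)
    then obtain p where "walk E p" "hd p = z" "last p = y" "length p = Suc n"
      using Suc.IH[of z] by blast
    then show "\<exists>p. walk E p \<and> hd p = x \<and> last p = y \<and> length p = Suc (Suc n)"
      using z by (intro exI[of _ "x # p"]) (auto simp: walk_def successively_Cons)
  qed
qed

lemma walk_rtranclp:
  "(\<exists>p. walk E p \<and> hd p = x \<and> last p = y) \<longleftrightarrow> (\<lambda>a b. {a, b} \<in> E)\<^sup>*\<^sup>* x y"
proof -
  have "(\<exists>p. walk E p \<and> hd p = x \<and> last p = y) \<longleftrightarrow>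
      (\<exists>n p. walk E p \<and> hd p = x \<and> last p = y \<and> length p = Suc n)"
    by (metis walk_def length_greater_0_conv gr0_conv_Suc)
  then show ?thesis by (simp add: walk_relpowp rtranclp_power)
qed

lemma graph_dist_relpowp: "graph_dist E x y = (LEAST n. ((\<lambda>a b. {a, b} \<in> E) ^^ n) x y)"
  by (simp add: graph_dist_def walk_relpowp)

lemma rtranclp_distinct_path:
  assumes "R\<^sup>*\<^sup>* a b"
  shows "\<exists>p. p \<noteq> [] \<and> distinct p \<and> successively R p \<and> hd p = a \<and> last p = b"
  using assms
proof (induction rule: converse_rtranclp_induct)
  case base
  then show ?case by (intro exI[of _ "[b]"]) auto
next
  case (step a c)
  then obtain p where p: "p \<noteq> []" "distinct p" "successively R p" "hd p = c" "last p = b" by blast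
  show ?case
  proof (cases "a \<in> set p")
    case True
    then obtain us vs where "p = us @ a # vs" by (meson split_list)
    then show ?thesis using p
      by (intro exI[of _ "a # vs"]) (auto simp: successively_append_iff)
  next
    case False
    then show ?thesis using p step.hyps
      by (intro exI[of _ "a # p"]) (auto simp: successively_Cons)
  qed
qed

text \<open>\<open>z\<close> is the successor of the last visit to \<open>x\<close> on a path to
  \<open>y\<close>.\<close>

lemma rtranclp_first_step:
  assumes "R\<^sup>*\<^sup>* x y" "y \<noteq> x"
  shows "\<exists>z. R x z \<and> (\<lambda>a b. R a b \<and> a \<noteq> x \<and> b \<noteq> x)\<^sup>*\<^sup>* z y"
  using assms
proof induction
  case (step u w)
  show ?case
  proof (cases "u = x")
    case False
    then obtain z where "R x z" "(\<lambda>a b. R a b \<and> a \<noteq> x \<and> b \<noteq> x)\<^sup>*\<^sup>* z u" using step by blast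
    then show ?thesis
      using False step by (metis (mono_tags, lifting) rtranclp.rtrancl_into_rtrancl)
  qed (use step in auto)
qed simp

locale regular_tree =
  fixes Q :: nat and E :: "'a set set"
  assumes tree: "homogeneous_tree Q UNIV E" and degree: "Q > 2"
begin

abbreviation adj :: "'a \<Rightarrow> 'a \<Rightarrow> bool" where "adj x y \<equiv> {x, y} \<in> E"

abbreviation nbrs :: "'a \<Rightarrow> 'a set" where "nbrs x \<equiv> {y. {x, y} \<in> E}"

definition avoid :: "'a \<Rightarrow> 'a \<Rightarrow> 'a \<Rightarrow> bool" where
  "avoid x a b \<longleftrightarrow> adj a b \<and> a \<noteq> x \<and> b \<noteq> x"

lemma finite_nbrs: "finite (nbrs x)" and card_nbrs: "card (nbrs x) = Q"
  using tree by (auto simp: homogeneous_tree_def)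

lemma no_loop: "{x} \<notin> E"
proof
  assume "{x} \<in> E"
  then have "card {x} = 2" using tree unfolding homogeneous_tree_def is_tree_def by blast
  then show False by simp
qed

lemma adj_neq: "adj x y \<Longrightarrow> x \<noteq> y"
  using no_loop by auto

lemma adj_sym: "adj x y \<longleftrightarrow> adj y x"
  by (simp add: insert_commute)

lemma connected: "adj\<^sup>*\<^sup>* x y"
proof -
  have "\<exists>p. walk E p \<and> hd p = x \<and> last p = y"
    using tree unfolding homogeneous_tree_def is_tree_def by blast
  then show ?thesis by (simp add: walk_rtranclp)
qed

lemma avoid_sym: "(avoid x)\<^sup>*\<^sup>* a b \<Longrightarrow> (avoid x)\<^sup>*\<^sup>* b a"
proof -
  have "symp (avoid x)" by (auto simp: symp_def avoid_def adj_sym)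
  then show "(avoid x)\<^sup>*\<^sup>* a b \<Longrightarrow> (avoid x)\<^sup>*\<^sup>* b a" by (meson symp_rtranclp sympD)
qed

text \<open>Acyclicity enters only through this lemma.\<close>

lemma nbrs_separated:
  assumes xy: "adj x y" and xz: "adj x z" and yz: "(avoid x)\<^sup>*\<^sup>* y z"
  shows "y = z"
proof (rule ccontr)
  assume "y \<noteq> z"
  obtain p where p: "p \<noteq> []" "distinct p" "successively (avoid x) p" "hd p = y" "last p = z"
    using rtranclp_distinct_path[OF yz] by blast
  have notin: "x \<notin> set p" if "successively (avoid x) p" "hd p \<noteq> x" for p
    using that
  proof (induction p)
    case (Cons a p)
    then show ?case by (cases p) (auto simp: avoid_def)
  qed simp
  have "x \<notin> set p" using p xy adj_neq by (intro notin) auto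
  \<comment> \<open>Two vertices besides \<open>x\<close> give \<open>x # p\<close> the length 3
    that \<open>is_cycle\<close> demands.\<close>
  moreover have "length p \<ge> 2"
    using p \<open>y \<noteq> z\<close> by (cases p rule: remdups_adj.cases) auto
  moreover have "walk E p"
    using p(1) successively_mono[OF p(3)] by (auto simp: walk_def avoid_def)
  ultimately have "is_cycle E (x # p)"
    using p xy xz by (auto simp: is_cycle_def walk_def successively_Cons insert_commute)
  then show False using tree unfolding homogeneous_tree_def is_tree_def by blast
qed

section \<open>Distances to vertices and to sets\<close>

lemma graph_dist_path: "(adj ^^ graph_dist E x y) x y"
  unfolding graph_dist_relpowp
  by (rule LeastI_ex) (use connected[of x y] in \<open>simp add: rtranclp_power\<close>)

lemma graph_dist_le: "(adj ^^ n) x y \<Longrightarrow> graph_dist E x y \<le> n"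
  unfolding graph_dist_relpowp by (rule Least_le)

lemma graph_dist_triangle: "graph_dist E x z \<le> graph_dist E x y + graph_dist E y z"
  by (rule graph_dist_le) (use graph_dist_path in \<open>auto simp: relpowp_add\<close>)

lemma dist_to_set_singleton: "dist_to_set E x {y} = graph_dist E x y"
  by (simp add: dist_to_set_def)

lemma dist_to_set_le: "y \<in> T \<Longrightarrow> dist_to_set E x T \<le> graph_dist E x y"
  unfolding dist_to_set_def by (rule cINF_lower) auto

lemma dist_to_set_attained: "T \<noteq> {} \<Longrightarrow> \<exists>y\<in>T. graph_dist E x y = dist_to_set E x T"
  unfolding dist_to_set_def using Inf_nat_def1[of "graph_dist E x ` T"] by auto

lemma graph_dist_refl: "graph_dist E x x = 0"
  using graph_dist_le[of 0 x x] by simp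

lemma graph_dist_eq_0_iff: "graph_dist E x y = 0 \<longleftrightarrow> x = y"
  using graph_dist_path[of x y] graph_dist_refl by auto

lemma dist_to_set_eq_0_iff: "T \<noteq> {} \<Longrightarrow> dist_to_set E x T = 0 \<longleftrightarrow> x \<in> T"
  using dist_to_set_attained[of T x] dist_to_set_le[of x T x]
  by (auto simp: graph_dist_eq_0_iff graph_dist_refl)

lemma graph_dist_adj: "adj x z \<Longrightarrow> graph_dist E x y \<le> Suc (graph_dist E z y)"
  by (rule graph_dist_le) (blast intro: relpowp_Suc_I2 graph_dist_path)

lemma dist_to_set_adj:
  assumes "T \<noteq> {}" "adj x z"
  shows "dist_to_set E x T \<le> Suc (dist_to_set E z T)"
proof -
  obtain y where "y \<in> T" "graph_dist E z y = dist_to_set E z T"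
    using dist_to_set_attained[OF assms(1)] by blast
  then show ?thesis using graph_dist_adj[OF assms(2), of y] dist_to_set_le[of y T x] by simp
qed

lemma graph_dist_SucD:
  assumes "graph_dist E x y = Suc k"
  shows "\<exists>z. adj x z \<and> graph_dist E z y = k"
proof -
  obtain z where z: "adj x z" "(adj ^^ k) z y"
    using graph_dist_path[of x y] unfolding assms by (blast dest: relpowp_Suc_D2)
  then show ?thesis using graph_dist_le[OF z(2)] graph_dist_adj[OF z(1), of y] assms by auto
qed

lemma dist_to_set_SucD:
  assumes "T \<noteq> {}" "dist_to_set E x T = Suc k"
  shows "\<exists>z. adj x z \<and> dist_to_set E z T = k"
proof -
  obtain y where y: "y \<in> T" "graph_dist E x y = Suc k"
    using dist_to_set_attained[OF assms(1), of x] assms(2) by auto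
  then obtain z where z: "adj x z" "graph_dist E z y = k" using graph_dist_SucD by blast
  then show ?thesis
    using dist_to_set_le[OF y(1), of z] dist_to_set_adj[OF assms(1) z(1)] assms(2)
    by (intro exI[of _ z]) auto
qed

text \<open>Along a shortest path from \<open>y\<close> to \<open>T\<close> every vertex after
  \<open>y\<close> is strictly closer to \<open>T\<close> than \<open>x\<close> is, so the path
  cannot meet \<open>x\<close>.\<close>

lemma descend_avoiding:
  assumes "T \<noteq> {}" "dist_to_set E y T \<le> dist_to_set E x T" "y \<noteq> x"
  shows "\<exists>t\<in>T. (avoid x)\<^sup>*\<^sup>* y t"
  using assms(2,3)
proof (induction "dist_to_set E y T" arbitrary: y)
  case 0
  then show ?case using dist_to_set_eq_0_iff[OF assms(1), of y] by auto
next
  case (Suc k)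
  obtain z where z: "adj y z" "dist_to_set E z T = k"
    using dist_to_set_SucD[OF assms(1)] Suc.hyps(2) by metis
  have "z \<noteq> x" using z Suc by auto
  then obtain t where "t \<in> T" "(avoid x)\<^sup>*\<^sup>* z t" using Suc z by fastforce
  moreover have "avoid x y z" using z \<open>z \<noteq> x\<close> Suc by (simp add: avoid_def)
  ultimately show ?case by (meson converse_rtranclp_into_rtranclp)
qed

section \<open>Connected vertex sets and nearest points\<close>

definition convex :: "'a set \<Rightarrow> bool" where
  "convex T \<longleftrightarrow> T \<noteq> {} \<and> (\<forall>s\<in>T. \<forall>t\<in>T. (\<lambda>a b. adj a b \<and> a \<in> T \<and> b \<in> T)\<^sup>*\<^sup>* s t)"

lemma convex_singleton: "convex {x}"
  by (simp add: convex_def)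

lemma convex_nonempty: "convex T \<Longrightarrow> T \<noteq> {}"
  by (simp add: convex_def)

text \<open>Both neighbours descend to \<open>T\<close> avoiding \<open>x\<close>, and
  \<open>T\<close> is connected without \<open>x\<close>, so separation identifies them. The
  non-strict bounds let \<open>parent\<close> also exclude neighbours at equal distance.\<close>

lemma closer_nbr_unique:
  assumes T: "convex T" and x: "x \<notin> T"
    and y: "adj x y" "dist_to_set E y T \<le> dist_to_set E x T"
    and z: "adj x z" "dist_to_set E z T \<le> dist_to_set E x T"
  shows "y = z"
proof -
  obtain s where s: "s \<in> T" "(avoid x)\<^sup>*\<^sup>* y s"
    using descend_avoiding[OF convex_nonempty[OF T] y(2)] adj_neq[OF y(1)] by blast
  obtain t where t: "t \<in> T" "(avoid x)\<^sup>*\<^sup>* z t"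
    using descend_avoiding[OF convex_nonempty[OF T] z(2)] adj_neq[OF z(1)] by blast
  have "(\<lambda>a b. adj a b \<and> a \<in> T \<and> b \<in> T)\<^sup>*\<^sup>* s t" using T s t by (simp add: convex_def)
  then have "(avoid x)\<^sup>*\<^sup>* s t"
    by (rule rtranclp_mono[THEN predicate2D, rotated]) (use x in \<open>auto simp: avoid_def\<close>)
  then have "(avoid x)\<^sup>*\<^sup>* y z" using s t avoid_sym by (meson rtranclp_trans)
  then show ?thesis using nbrs_separated y z by blast
qed

lemma parent:
  assumes T: "convex T" and x: "x \<notin> T"
  obtains p where "adj x p" "dist_to_set E x T = Suc (dist_to_set E p T)"
    "\<And>y. adj x y \<Longrightarrow> y \<noteq> p \<Longrightarrow> dist_to_set E y T = Suc (dist_to_set E x T)"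
proof -
  have ne: "T \<noteq> {}" using T by (rule convex_nonempty)
  obtain k where k: "dist_to_set E x T = Suc k"
    using x dist_to_set_eq_0_iff[OF ne, of x] by (cases "dist_to_set E x T") auto
  then obtain p where p: "adj x p" "dist_to_set E p T = k" using dist_to_set_SucD[OF ne] by blast
  show thesis
  proof
    fix y assume y: "adj x y" "y \<noteq> p"
    then have "\<not> dist_to_set E y T \<le> dist_to_set E x T"
      using closer_nbr_unique[OF T x y(1) _ p(1)] p(2) k by auto
    moreover have "dist_to_set E y T \<le> Suc (dist_to_set E x T)"
      using dist_to_set_adj[OF ne, of y x] y(1) adj_sym by blast
    ultimately show "dist_to_set E y T = Suc (dist_to_set E x T)" by simp
  qed (use p k in auto)
qed

text \<open>The first step of a shortest path from \<open>x\<close> to a nearest point leads closer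
  to \<open>T\<close>, hence to \<open>p\<close>. Existence and uniqueness of nearest points thus
  pass from \<open>p\<close> to \<open>x\<close>.\<close>

lemma nearest_step:
  assumes T: "convex T" and p: "adj x p" "dist_to_set E x T = Suc (dist_to_set E p T)"
  shows "y \<in> T \<and> graph_dist E x y = dist_to_set E x T \<longleftrightarrow>
    y \<in> T \<and> graph_dist E p y = dist_to_set E p T"
proof (intro iffI conjI; elim conjE)
  assume y: "y \<in> T" "graph_dist E x y = dist_to_set E x T"
  then obtain z where z: "adj x z" "graph_dist E z y = dist_to_set E p T"
    using graph_dist_SucD p(2) by metis
  moreover have "x \<notin> T" using p(2) dist_to_set_eq_0_iff[OF convex_nonempty[OF T], of x] by auto
  moreover have "dist_to_set E z T \<le> dist_to_set E x T"
    using dist_to_set_le[OF y(1), of z] z p(2) by simp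
  ultimately have "z = p" using closer_nbr_unique[OF T _ z(1) _ p(1)] p(2) by auto
  then show "graph_dist E p y = dist_to_set E p T" using z by simp
next
  assume y: "y \<in> T" "graph_dist E p y = dist_to_set E p T"
  then show "graph_dist E x y = dist_to_set E x T"
    using graph_dist_adj[OF p(1), of y] dist_to_set_le[OF y(1), of x] p(2) by simp
qed

lemma nearest_exists_unique:
  assumes T: "convex T"
  shows "\<exists>!y. y \<in> T \<and> graph_dist E x y = dist_to_set E x T"
proof (induction "dist_to_set E x T" arbitrary: x)
  case 0
  then have "x \<in> T" using dist_to_set_eq_0_iff[OF convex_nonempty[OF T], of x] by simp
  then show ?case
    using 0 by (auto simp: graph_dist_eq_0_iff)
next
  case (Suc k)
  obtain p where p: "adj x p" "dist_to_set E p T = k"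
    using dist_to_set_SucD[OF convex_nonempty[OF T]] Suc.hyps(2) by metis
  then show ?case
    using nearest_step[OF T p(1)] Suc.hyps(1)[of p] Suc.hyps(2) by simp
qed

lemma nearest_vertex_step:
  assumes "convex T" "adj x p" "dist_to_set E x T = Suc (dist_to_set E p T)"
  shows "nearest_vertex E T x = nearest_vertex E T p"
  unfolding nearest_vertex_def nearest_step[OF assms] ..

lemma nearest_vertex_self: "convex T \<Longrightarrow> x \<in> T \<Longrightarrow> nearest_vertex E T x = x"
  unfolding nearest_vertex_def
  using dist_to_set_eq_0_iff[OF convex_nonempty, of T x]
  by (intro the_equality) (auto simp: graph_dist_eq_0_iff)

lemma graph_dist_nearest_vertex:
  "convex T \<Longrightarrow> graph_dist E x (nearest_vertex E T x) = dist_to_set E x T"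
  unfolding nearest_vertex_def using theI'[OF nearest_exists_unique, of T x] by auto

end

section \<open>Spherical functions\<close>

text \<open>The radial eigenfunction of the \<open>q\<close>-regular tree with eigenvalue
  \<open>t\<close>, normalized at the root: the root has \<open>q\<close> children, every other
  vertex one parent and \<open>q - 1\<close> children.\<close>

fun sph :: "nat \<Rightarrow> real \<Rightarrow> nat \<Rightarrow> real" where
  "sph q t 0 = 1"
| "sph q t (Suc 0) = t / real q"
| "sph q t (Suc (Suc k)) = (t * sph q t (Suc k) - sph q t k) / (real q - 1)"

lemma sph_recurrence:
  "q > 1 \<Longrightarrow> sph q t k + (real q - 1) * sph q t (Suc (Suc k)) = t * sph q t (Suc k)"
  by simp

text \<open>If all values were positive, the ratio of consecutive ones would decrease by a fixed amount
  at every step, since \<open>(q - 1) \<rho> + 1 / \<rho> - t \<ge> 2 * sqrt (q - 1) - t > 0\<close>.\<close>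

lemma sph_oscillates:
  assumes q: "q > 2" and t: "t < 2 * sqrt (real q - 1)"
  shows "\<exists>k. sph q t k \<le> 0"
proof (rule ccontr)
  assume "\<not> ?thesis"
  then have pos: "sph q t k > 0" for k by (auto simp: not_le)
  define m where "m = real q - 1"
  have m: "m > 0" using q by (simp add: m_def)
  define \<delta> where "\<delta> = (2 * sqrt m - t) / m"
  have \<delta>: "\<delta> > 0" using t m by (simp add: \<delta>_def m_def)
  define \<rho> where "\<rho> = (\<lambda>k. sph q t (Suc k) / sph q t k)"
  have \<rho>: "\<rho> k > 0" for k using pos by (simp add: \<rho>_def)
  have step: "\<rho> (Suc k) \<le> \<rho> k - \<delta>" for k
  proof -
    have "\<rho> (Suc k) = (t - 1 / \<rho> k) / m"
      using pos[of k] pos[of "Suc k"] m by (simp add: \<rho>_def m_def field_simps)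
    moreover have "2 * sqrt m \<le> m * \<rho> k + 1 / \<rho> k"
    proof -
      have "0 \<le> (sqrt m * \<rho> k - 1)\<^sup>2 / \<rho> k" using \<rho>[of k] by simp
      also have "\<dots> = m * \<rho> k + 1 / \<rho> k - 2 * sqrt m"
        using \<rho>[of k] m by (simp add: power2_diff power_mult_distrib field_simps power2_eq_square)
      finally show ?thesis by simp
    qed
    ultimately show ?thesis using m by (simp add: \<delta>_def field_simps)
  qed
  have "\<rho> k \<le> \<rho> 0 - real k * \<delta>" for k
  proof (induction k)
    case (Suc k)
    then show ?case using step[of k] by (simp add: algebra_simps)
  qed simp
  moreover obtain k where "real k * \<delta> > \<rho> 0"
    using reals_Archimedean3[OF \<delta>] by blast
  ultimately show False using \<rho>[of k] by (metis diff_less_0_iff_less less_le_trans not_less_iff_gr_or_eq)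
qed

text \<open>At this eigenvalue the characteristic polynomial of the recurrence has the double root
  \<open>1 / sqrt (q - 1)\<close>, hence a linear factor times a geometric sequence.\<close>

lemma sph_critical:
  assumes q: "q > 2"
  shows "sph q (2 * sqrt (real q - 1)) k =
    (1 + (real q - 2) / real q * real k) / sqrt (real q - 1) ^ k"
proof -
  define s where "s = sqrt (real q - 1)"
  have s: "s > 0" "real q = s\<^sup>2 + 1" using q by (auto simp: s_def)
  define c where "c = (real q - 2) / real q"
  have c: "1 + c = 2 * s\<^sup>2 / real q" using q s(2) by (simp add: c_def field_simps)
  have "sph q (2 * s) k = (1 + c * real k) / s ^ k"
    using s c
  proof (induction q "2 * s" k rule: sph.induct)
    case (2 q)
    show ?case using 2 by (simp add: power2_eq_square)
  next
    case (3 q k)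
    have "sph q (2 * s) (Suc (Suc k)) =
        (2 * s * ((1 + c * real (Suc k)) / s ^ Suc k) - (1 + c * real k) / s ^ k) / s\<^sup>2"
      using 3 by simp
    also have "\<dots> = (1 + c * real (Suc (Suc k))) / s ^ Suc (Suc k)"
      using s(1) by (simp add: field_simps power2_eq_square)
    finally show ?case .
  qed simp
  then show ?thesis by (simp add: s_def c_def)
qed

lemma continuous_on_sph [continuous_intros]:
  assumes "continuous_on A g"
  shows "continuous_on A (\<lambda>a. sph q (g a) k)"
proof (induction k rule: nat_less_induct)
  case (1 k)
  show ?case
  proof (cases k)
    case (Suc j)
    then show ?thesis using 1 assms by (cases j) (auto simp: divide_inverse intro!: continuous_intros)
  qed simp
qed

text \<open>The part of the eigenvalue \<open>1 / a + (Q - 1) * a\<close> left to the subtree: the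
  branches outside it take \<open>(Q - q) * a\<close> and the loop takes 1.\<close>

definition theta :: "nat \<Rightarrow> real \<Rightarrow> real" where
  "theta q a = 1 / a + (real q - 1) * a - 1"

lemma theta_eq:
  assumes "a > 0" "q > 0"
  shows "theta q a = 2 * sqrt (real q - 1) + ((1 - sqrt (real q - 1) * a)\<^sup>2 / a - 1)"
proof -
  define s where "s = sqrt (real q - 1)"
  have "real q - 1 = s\<^sup>2" using assms by (simp add: s_def)
  then show ?thesis
    unfolding theta_def s_def[symmetric] using assms(1)
    by (simp add: field_simps power2_eq_square)
qed

lemma continuous_on_theta [continuous_intros]:
  "A \<subseteq> {0<..} \<Longrightarrow> continuous_on A (theta q)"
  unfolding theta_def by (auto intro!: continuous_intros)

text \<open>The spherical function with eigenvalue \<open>theta q a\<close> is to be continued past radius \<open>n\<close> by the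
  geometric sequence of ratio \<open>a\<close>. The least \<open>a\<close> at which the matching fails to be strict at
  some radius \<open>k \<le> n\<close> works: there it cannot be an equality at \<open>k < n\<close>, since the recurrence would
  give the wrong sign at \<open>Suc k\<close>.\<close>

lemma matching_decay_exists:
  assumes q: "q > 2" and \<alpha>: "0 < \<alpha>" "(1 - sqrt (real q - 1) * \<alpha>)\<^sup>2 = \<alpha>"
    and \<beta>: "\<alpha> < \<beta>" "\<beta> * sqrt (real q - 1) \<le> 1"
  shows "\<forall>\<^sub>F n in sequentially. \<exists>a>\<alpha>. a \<le> \<beta> \<and>
    sph q (theta q a) (Suc n) = a * sph q (theta q a) n \<and>
    (\<forall>k\<le>Suc n. sph q (theta q a) k > 0)"
proof -
  define s where "s = sqrt (real q - 1)"
  have s: "s > 0" "s\<^sup>2 = real q - 1" using q by (auto simp: s_def)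
  have \<alpha>s: "\<alpha> * s < 1"
    using mult_strict_right_mono[OF \<beta>(1) s(1)] \<beta>(2) by (simp add: s_def)
  \<comment> \<open>From \<open>\<alpha>\<close> to \<open>\<beta>\<close> the square
    \<open>(1 - s * a)\<^sup>2\<close> does not grow while \<open>a\<close> does, so
    \<open>theta\<close> falls below the critical value.\<close>
  have "theta q \<beta> < 2 * sqrt (real q - 1)"
  proof -
    have "(1 - s * \<beta>)\<^sup>2 \<le> (1 - s * \<alpha>)\<^sup>2"
      using \<beta> s by (intro power_mono) (auto simp: s_def mult.commute)
    also have "\<dots> < \<beta>" using \<alpha> \<beta>(1) by (simp add: s_def)
    finally have "(1 - s * \<beta>)\<^sup>2 / \<beta> < 1" using \<alpha>(1) \<beta>(1) by simp
    then show ?thesis using theta_eq[of \<beta> q] \<alpha>(1) \<beta>(1) q by (simp add: s_def)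
  qed
  then obtain K where K: "sph q (theta q \<beta>) K \<le> 0" using sph_oscillates[OF q] by blast
  \<comment> \<open>The mismatch at radius \<open>k\<close> with a geometric continuation of ratio
    \<open>a\<close>.\<close>
  define D where "D = (\<lambda>k a. sph q (theta q a) (Suc k) - a * sph q (theta q a) k)"
  have D_cont: "continuous_on {\<alpha>..\<beta>} (D k)" for k
    unfolding D_def using \<alpha>(1) by (intro continuous_intros) auto
  have D_\<alpha>: "D k \<alpha> > 0" for k
  proof -
    define c where "c = (real q - 2) / real q"
    have c: "c > 0" using q by (simp add: c_def)
    have th: "theta q \<alpha> = 2 * s" using theta_eq[OF \<alpha>(1), of q] \<alpha> q by (simp add: s_def)
    have val: "sph q (2 * s) j = (1 + c * real j) / s ^ j" for j
      using sph_critical[OF q] by (simp add: s_def c_def)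
    have "D k \<alpha> = ((1 + c * real (Suc k)) - \<alpha> * s * (1 + c * real k)) / s ^ Suc k"
      unfolding D_def th val using s(1) by (simp add: field_simps)
    moreover have "\<alpha> * s * (1 + c * real k) < 1 * (1 + c * real k)"
      using \<alpha>s c by (intro mult_strict_right_mono) (simp_all add: add_pos_nonneg)
    ultimately show ?thesis using s c by (simp add: algebra_simps)
  qed
  have pos: "sph q (theta q a) k > 0" if "\<And>j. j < k \<Longrightarrow> D j a \<ge> 0" "\<alpha> \<le> a" for a k
    using that(1)
  proof (induction k)
    case (Suc k)
    then have "0 < a * sph q (theta q a) k" using \<alpha>(1) that(2) by simp
    then show ?case using Suc.prems[of k] by (simp add: D_def)
  qed simp
  have "\<exists>a>\<alpha>. a \<le> \<beta> \<and> sph q (theta q a) (Suc n) = a * sph q (theta q a) n \<and>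
    (\<forall>k\<le>Suc n. sph q (theta q a) k > 0)" if n: "n \<ge> K" for n
  proof -
    define X where "X = (\<Union>k\<in>{..n}. {a\<in>{\<alpha>..\<beta>}. D k a \<le> 0})"
    have "compact X"
      unfolding X_def
      using continuous_on_closed_Collect_le[OF D_cont continuous_on_const]
      by (intro compact_UN) (auto simp: compact_eq_bounded_closed intro: bounded_subset[of "{\<alpha>..\<beta>}"])
    moreover have "X \<noteq> {}"
    proof
      \<comment> \<open>Strict matching at \<open>\<beta>\<close> up to radius \<open>n\<close>
        would force positivity at \<open>K\<close>, against the choice of \<open>K\<close>.\<close>
      assume "X = {}"
      moreover have "\<beta> \<in> X" if "k \<le> n" "D k \<beta> \<le> 0" for k
        unfolding X_def using that \<beta>(1) by auto
      ultimately have "D k \<beta> > 0" if "k \<le> n" for k using that not_le by blast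
      then have "sph q (theta q \<beta>) K > 0" using n \<beta>(1) by (intro pos) (auto simp: less_imp_le)
      then show False using K by simp
    qed
    ultimately obtain a where a: "a \<in> X" and least: "\<And>b. b \<in> X \<Longrightarrow> a \<le> b"
      using compact_attains_inf by metis
    from a obtain k where k: "k \<le> n" "D k a \<le> 0" and a_in: "\<alpha> \<le> a" "a \<le> \<beta>"
      by (auto simp: X_def)
    have "a \<noteq> \<alpha>" using k(2) D_\<alpha>[of k] by auto
    then have a_gt: "\<alpha> < a" using a_in by simp
    \<comment> \<open>A negative value at \<open>a\<close> would, since \<open>D j\<close> is
      positive at \<open>\<alpha>\<close>, give a zero before \<open>a\<close> and so a smaller
      element of \<open>X\<close>.\<close>
    have D_nonneg: "D j a \<ge> 0" if j: "j \<le> n" for j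
    proof (rule ccontr)
      assume "\<not> ?thesis"
      moreover have "continuous_on {\<alpha>..a} (D j)"
        using a_in by (intro continuous_on_subset[OF D_cont]) auto
      ultimately obtain b where b: "\<alpha> \<le> b" "b \<le> a" "D j b = 0"
        using IVT2'[of "D j" a 0 \<alpha>] D_\<alpha>[of j] a_in by (auto simp: less_imp_le)
      then have "b \<in> X" using j a_in by (auto simp: X_def intro!: bexI[of _ j])
      then have "b = a" using least b by force
      then show False using \<open>\<not> 0 \<le> D j a\<close> b by simp
    qed
    have sph_pos: "sph q (theta q a) j > 0" if "j \<le> Suc n" for j
      using that a_in D_nonneg by (intro pos) auto
    have D0: "D k a = 0" using k D_nonneg[of k] by simp
    have "k = n"
    proof (rule ccontr)
      assume "k \<noteq> n"
      then have k': "Suc k \<le> n" using k by simp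
      define g where "g = sph q (theta q a) (Suc k)"
      have g: "g > 0" using sph_pos[of "Suc k"] k' by (simp add: g_def)
      have prev: "sph q (theta q a) k = g / a" using D0 a_gt \<alpha>(1) by (simp add: D_def g_def)
      \<comment> \<open>The geometric terms cancel; what remains comes from the loop term
        \<open>- 1\<close> in \<open>theta\<close>.\<close>
      have "D (Suc k) a = (theta q a * g - g / a) / (real q - 1) - a * g"
        by (simp add: D_def g_def[symmetric] prev)
      also have "\<dots> = - g / (real q - 1)"
        using q a_gt \<alpha>(1) by (simp add: theta_def field_simps)
      also have "\<dots> < 0" using g q by simp
      finally show False using D_nonneg[OF k'] by simp
    qed
    then show ?thesis
      using D0 a_gt a_in sph_pos by (intro exI[of _ a]) (auto simp: D_def)
  qed
  then show ?thesis unfolding eventually_sequentially by blast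
qed

section \<open>Eigenfunctions adapted to a regular subtree\<close>

lemma adjacency_eq: "adjacency E x y = of_bool ({x, y} \<in> E)"
proof -
  have "{e \<in> E. e = {x, y}} = (if {x, y} \<in> E then {{x, y}} else {})" by auto
  then show ?thesis by (simp add: adjacency_def)
qed

lemma add_loops_empty: "add_loops E {} = E"
  by (simp add: add_loops_def)

section \<open>Loops on the tree and growth of spheres\<close>

context regular_tree
begin

lemma adjacency_add_loops:
  "adjacency (add_loops E T) x y = of_bool (adj x y) + of_bool (x = y \<and> x \<in> T)"
proof -
  have "{x, y} \<in> (\<lambda>x. {x}) ` T \<longleftrightarrow> x = y \<and> x \<in> T" by (auto simp: doubleton_eq_iff)
  then show ?thesis using no_loop by (auto simp: adjacency_eq add_loops_def)
qed

sublocale loops: symmetric_matrix "adjacency (add_loops E T)" for T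
proof
  fix x y
  show "adjacency (add_loops E T) x y \<ge> 0" by (simp add: adjacency_eq)
  show "adjacency (add_loops E T) x y = adjacency (add_loops E T) y x"
    by (simp add: adjacency_eq insert_commute)
  have "{y. adjacency (add_loops E T) x y \<noteq> 0} \<subseteq> insert x (nbrs x)"
    by (auto simp: adjacency_add_loops)
  then show "finite {y. adjacency (add_loops E T) x y \<noteq> 0}"
    by (rule finite_subset) (simp add: finite_nbrs)
qed

lemma act_loops: "loops.act T u x = (\<Sum>y\<in>nbrs x. u y) + of_bool (x \<in> T) * u x"
proof -
  have "((\<lambda>y. adjacency (add_loops E T) x y * u y) has_sum
      (\<Sum>y\<in>insert x (nbrs x). adjacency (add_loops E T) x y * u y)) UNIV"
    by (rule has_sum_finite_neutralI) (auto simp: finite_nbrs adjacency_add_loops)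
  then have "loops.act T u x = (\<Sum>y\<in>insert x (nbrs x). adjacency (add_loops E T) x y * u y)"
    by (rule loops.act_eqI)
  also have "\<dots> = (\<Sum>y\<in>nbrs x. u y) + of_bool (x \<in> T) * u x"
    using no_loop by (subst sum.insert) (auto simp: finite_nbrs adjacency_add_loops intro!: sum.cong)
  finally show ?thesis .
qed

lemma loops_irreducible: "(\<lambda>x y. adjacency (add_loops E T) x y > 0)\<^sup>*\<^sup>* x y"
  by (rule rtranclp_mono[THEN predicate2D, OF _ connected]) (auto simp: adjacency_add_loops)

definition level :: "'a \<Rightarrow> nat \<Rightarrow> 'a set" where
  "level r k = {x. graph_dist E x r = k}"

text \<open>Every vertex off the root spends one of its \<open>Q\<close> neighbours on its parent,
  leaving at most \<open>Q - 1\<close> in the next level. The exponent \<open>k\<close> instead of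
  \<open>k - 1\<close> keeps one formula for all levels.\<close>

lemma finite_level: "finite (level r k)"
  and card_level: "card (level r k) \<le> Q * (Q - 1) ^ k"
proof -
  have 0: "level r 0 = {r}" by (auto simp: level_def graph_dist_eq_0_iff)
  have 1: "level r 1 \<subseteq> nbrs r"
    using graph_dist_SucD[of _ r 0] adj_sym by (auto simp: level_def graph_dist_eq_0_iff)
  have step: "\<exists>A. (\<forall>x\<in>level r (Suc k). finite (A x) \<and> card (A x) \<le> Q - 1) \<and>
      level r (Suc (Suc k)) \<subseteq> (\<Union>x\<in>level r (Suc k). A x)" for k
  proof -
    define A where "A = (\<lambda>x. {y \<in> nbrs x. graph_dist E y r = Suc (graph_dist E x r)})"
    have "finite (A x) \<and> card (A x) \<le> Q - 1" if "x \<in> level r (Suc k)" for x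
    proof -
      have "x \<notin> {r}" using that by (auto simp: level_def graph_dist_refl)
      from parent[OF convex_singleton this] obtain p
        where p: "adj x p" "graph_dist E x r = Suc (graph_dist E p r)"
        by (simp add: dist_to_set_singleton) metis
      then have "A x \<subseteq> nbrs x - {p}" by (auto simp: A_def)
      moreover have "card (nbrs x - {p}) = Q - 1"
        using p(1) by (simp add: card_Diff_singleton card_nbrs)
      ultimately show ?thesis
        using finite_nbrs[of x] by (metis card_mono finite_Diff finite_subset)
    qed
    moreover have "level r (Suc (Suc k)) \<subseteq> (\<Union>x\<in>level r (Suc k). A x)"
    proof
      fix y assume y: "y \<in> level r (Suc (Suc k))"
      then obtain z where "adj y z" "graph_dist E z r = Suc k"
        using graph_dist_SucD[of y r "Suc k"] by (auto simp: level_def)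
      then show "y \<in> (\<Union>x\<in>level r (Suc k). A x)"
        using y adj_sym by (auto simp: level_def A_def)
    qed
    ultimately show ?thesis by blast
  qed
  have "finite (level r (Suc k)) \<and> card (level r (Suc k)) \<le> Q * (Q - 1) ^ k" for k
  proof (induction k)
    case 0
    show ?case
      using 1 finite_nbrs[of r] card_mono[OF finite_nbrs 1] card_nbrs[of r] finite_subset by auto
  next
    case (Suc k)
    obtain A where A: "\<And>x. x \<in> level r (Suc k) \<Longrightarrow> finite (A x) \<and> card (A x) \<le> Q - 1"
      and sub: "level r (Suc (Suc k)) \<subseteq> (\<Union>x\<in>level r (Suc k). A x)"
      using step[of k] by blast
    have fin: "finite (\<Union>x\<in>level r (Suc k). A x)" using A Suc by blast
    have "card (level r (Suc (Suc k))) \<le> card (\<Union>x\<in>level r (Suc k). A x)"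
      by (rule card_mono[OF fin sub])
    also have "\<dots> \<le> (\<Sum>x\<in>level r (Suc k). card (A x))"
      using Suc by (intro card_UN_le) auto
    also have "\<dots> \<le> (\<Sum>x\<in>level r (Suc k). Q - 1)" using A by (intro sum_mono) auto
    also have "\<dots> \<le> Q * (Q - 1) ^ k * (Q - 1)" using Suc by simp
    finally show ?case using finite_subset[OF sub fin] by (simp add: mult_ac)
  qed note * = this
  show "finite (level r k)" using * 0 by (cases k) auto
  show "card (level r k) \<le> Q * (Q - 1) ^ k"
  proof (cases k)
    case 0
    then show ?thesis using \<open>level r 0 = {r}\<close> degree by simp
  next
    case (Suc j)
    have "Q * (Q - 1) ^ j \<le> Q * (Q - 1) ^ k" using Suc degree by simp
    then show ?thesis using * Suc by (meson order_trans)
  qed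
qed

text \<open>Level \<open>k\<close> contributes at most a constant times
  \<open>((Q - 1) * a\<^sup>2) ^ k\<close>, the terms of a convergent geometric series.\<close>

lemma geometric_square_summable:
  assumes a: "a > 0" "(real Q - 1) * a\<^sup>2 < 1"
    and w: "\<And>x. w x \<ge> 0" "\<And>x. w x \<le> C * a ^ graph_dist E x r"
  shows "(\<lambda>x. (w x)\<^sup>2) summable_on UNIV"
proof (rule nonneg_bdd_above_summable_on)
  define t where "t = (real Q - 1) * a\<^sup>2"
  have t: "t \<ge> 0" "t < 1" using a degree by (auto simp: t_def)
  show "bdd_above (sum (\<lambda>x. (w x)\<^sup>2) ` {X. X \<subseteq> UNIV \<and> finite X})"
  proof (rule bdd_aboveI2)
    fix X :: "'a set" assume "X \<in> {X. X \<subseteq> UNIV \<and> finite X}"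
    then have X: "finite X" by simp
    obtain m where m: "\<And>x. x \<in> X \<Longrightarrow> graph_dist E x r \<le> m"
      using X finite_nat_set_iff_bounded_le[of "(\<lambda>x. graph_dist E x r) ` X"] by auto
    have "(\<Sum>x\<in>X. (w x)\<^sup>2) \<le> (\<Sum>x\<in>(\<Union>k\<in>{..m}. level r k). (w x)\<^sup>2)"
      using m finite_level by (intro sum_mono2) (auto simp: level_def)
    also have "\<dots> = (\<Sum>k\<le>m. \<Sum>x\<in>level r k. (w x)\<^sup>2)"
      using finite_level by (intro sum.UNION_disjoint) (auto simp: level_def)
    also have "\<dots> \<le> (\<Sum>k\<le>m. C\<^sup>2 * real Q * t ^ k)"
    proof (rule sum_mono)
      fix k
      have "(\<Sum>x\<in>level r k. (w x)\<^sup>2) \<le> (\<Sum>x\<in>level r k. (C * a ^ k)\<^sup>2)"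
        using w by (intro sum_mono power_mono) (auto simp: level_def)
      also have "\<dots> = real (card (level r k)) * (C * a ^ k)\<^sup>2" by simp
      also have "\<dots> \<le> real (Q * (Q - 1) ^ k) * (C * a ^ k)\<^sup>2"
        using card_level[of r k] by (intro mult_right_mono) (simp_all only: of_nat_le_iff zero_le_power2)
      also have "\<dots> = C\<^sup>2 * real Q * t ^ k"
        using degree
        by (simp add: t_def of_nat_diff power_mult_distrib power_mult[symmetric] mult_ac)
      finally show "(\<Sum>x\<in>level r k. (w x)\<^sup>2) \<le> C\<^sup>2 * real Q * t ^ k" .
    qed
    also have "\<dots> \<le> (\<Sum>k. C\<^sup>2 * real Q * t ^ k)"
      using t by (intro sum_le_suminf summable_mult summable_geometric) auto
    finally show "(\<Sum>x\<in>X. (w x)\<^sup>2) \<le> (\<Sum>k. C\<^sup>2 * real Q * t ^ k)" .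
  qed
qed simp

end

section \<open>A regular subtree and functions radial on it\<close>

locale regular_subtree = regular_tree Q E for Q E +
  fixes q :: nat and S :: "'a set" and F :: "'a set set" and r :: 'a
  assumes subtree: "homogeneous_tree q S F" "F \<subseteq> E" and root: "r \<in> S"
begin

lemma F_subset: "{x, y} \<in> F \<Longrightarrow> x \<in> S \<and> y \<in> S \<and> adj x y"
  using subtree unfolding homogeneous_tree_def is_tree_def by blast

lemma F_connected: "x \<in> S \<Longrightarrow> y \<in> S \<Longrightarrow> (\<lambda>a b. {a, b} \<in> F)\<^sup>*\<^sup>* x y"
proof -
  assume "x \<in> S" "y \<in> S"
  then have "\<exists>p. walk F p \<and> hd p = x \<and> last p = y"
    using subtree(1) unfolding homogeneous_tree_def is_tree_def by blast
  then show ?thesis by (simp add: walk_rtranclp)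
qed

lemma S_convex: "convex S"
  unfolding convex_def
proof (intro conjI ballI)
  fix s t assume "s \<in> S" "t \<in> S"
  then have "(\<lambda>a b. {a, b} \<in> F)\<^sup>*\<^sup>* s t" by (rule F_connected)
  then show "(\<lambda>a b. adj a b \<and> a \<in> S \<and> b \<in> S)\<^sup>*\<^sup>* s t"
    by (rule rtranclp_mono[THEN predicate2D, rotated]) (use F_subset in blast)
qed (use root in auto)

lemma F_first_step:
  assumes "x \<in> S" "y \<in> S" "y \<noteq> x"
  obtains z where "{x, z} \<in> F" "(avoid x)\<^sup>*\<^sup>* z y"
proof -
  obtain z where z: "{x, z} \<in> F" "(\<lambda>a b. {a, b} \<in> F \<and> a \<noteq> x \<and> b \<noteq> x)\<^sup>*\<^sup>* z y"
    using rtranclp_first_step[OF F_connected[OF assms(1,2)] assms(3)] by blast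
  have "(avoid x)\<^sup>*\<^sup>* z y"
    using z(2) by (rule rtranclp_mono[THEN predicate2D, rotated]) (use F_subset in \<open>auto simp: avoid_def\<close>)
  then show thesis using that z(1) by blast
qed

text \<open>The subtree is induced: an \<open>F\<close>-path from \<open>x\<close> to a neighbour
  \<open>y\<close> in \<open>S\<close> leaves \<open>x\<close> through some \<open>z\<close> joined
  to \<open>y\<close> without \<open>x\<close>, and separation gives \<open>z = y\<close>.\<close>

lemma nbrs_Int_S: "x \<in> S \<Longrightarrow> nbrs x \<inter> S = {y. {x, y} \<in> F}"
proof (intro equalityI subsetI)
  fix y assume "x \<in> S" "y \<in> nbrs x \<inter> S"
  then have y: "y \<in> S" "adj x y" "y \<noteq> x" using adj_neq by auto
  obtain z where "{x, z} \<in> F" "(avoid x)\<^sup>*\<^sup>* z y" using F_first_step \<open>x \<in> S\<close> y(1,3) by blast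
  then show "y \<in> {y. {x, y} \<in> F}" using nbrs_separated[of x z y] F_subset y(2) by blast
qed (use F_subset in blast)

lemma card_nbrs_Int_S: "x \<in> S \<Longrightarrow> card (nbrs x \<inter> S) = q"
  using subtree(1) by (simp add: nbrs_Int_S homogeneous_tree_def)

lemma card_nbrs_Diff_S:
  assumes "x \<in> S"
  shows "real (card (nbrs x - S)) = real Q - real q"
proof -
  have "card (nbrs x - S) + card (nbrs x \<inter> S) = Q"
    by (metis Int_Diff_Un Int_Diff_disjoint card_Un_disjoint card_nbrs finite_Diff finite_Int finite_nbrs add.commute)
  then show ?thesis using card_nbrs_Int_S[OF assms] by linarith
qed

lemma parent_in_S:
  assumes x: "x \<in> S" "x \<noteq> r" and p: "adj x p" "graph_dist E x r = Suc (graph_dist E p r)"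
  shows "p \<in> S"
proof -
  obtain z where z: "{x, z} \<in> F" "(avoid x)\<^sup>*\<^sup>* z r" using F_first_step x root by metis
  have "(avoid x)\<^sup>*\<^sup>* p r"
    using descend_avoiding[of "{r}" p x] p adj_neq by (auto simp: dist_to_set_singleton)
  then have "z = p"
    using z nbrs_separated[of x z p] F_subset p(1) avoid_sym by (meson rtranclp_trans)
  then show ?thesis using z F_subset by blast
qed

definition profile :: "real \<Rightarrow> (nat \<Rightarrow> real) \<Rightarrow> 'a \<Rightarrow> real" where
  "profile a f x = a ^ dist_to_set E x S * f (graph_dist E (nearest_vertex E S x) r)"

lemma S_nonempty: "S \<noteq> {}"
  using root by blast

lemma profile_in_S: "x \<in> S \<Longrightarrow> profile a f x = f (graph_dist E x r)"
  using dist_to_set_eq_0_iff[OF S_nonempty, of x]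
  by (simp add: profile_def nearest_vertex_self[OF S_convex])

lemma profile_step:
  "adj x p \<Longrightarrow> dist_to_set E x S = Suc (dist_to_set E p S) \<Longrightarrow> profile a f x = a * profile a f p"
  by (simp add: profile_def nearest_vertex_step[OF S_convex])

lemma profile_outer_nbr:
  assumes "x \<in> S" "y \<in> nbrs x - S"
  shows "profile a f y = a * f (graph_dist E x r)"
proof -
  have "dist_to_set E x S = 0" using assms dist_to_set_eq_0_iff[OF S_nonempty] by simp
  moreover have "dist_to_set E y S \<noteq> 0" using assms dist_to_set_eq_0_iff[OF S_nonempty] by simp
  moreover have "adj y x" using assms adj_sym by blast
  ultimately have "dist_to_set E y S = Suc (dist_to_set E x S)"
    using dist_to_set_adj[OF S_nonempty, of y x] by simp
  then show ?thesis using profile_step[OF \<open>adj y x\<close>] profile_in_S[OF assms(1)] by simp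
qed

lemma sum_nbrs_in_S:
  assumes "x \<in> S"
  shows "(\<Sum>y\<in>nbrs x. profile a f y) =
    (\<Sum>y\<in>nbrs x \<inter> S. f (graph_dist E y r)) + (real Q - real q) * (a * f (graph_dist E x r))"
proof -
  have "(\<Sum>y\<in>nbrs x. profile a f y) =
      (\<Sum>y\<in>nbrs x \<inter> S. profile a f y) + (\<Sum>y\<in>nbrs x - S. profile a f y)"
    by (subst sum.Int_Diff[OF finite_nbrs, of _ _ S]) simp
  also have "(\<Sum>y\<in>nbrs x \<inter> S. profile a f y) = (\<Sum>y\<in>nbrs x \<inter> S. f (graph_dist E y r))"
    by (intro sum.cong) (auto simp: profile_in_S)
  also have "(\<Sum>y\<in>nbrs x - S. profile a f y) = (\<Sum>y\<in>nbrs x - S. a * f (graph_dist E x r))"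
    by (intro sum.cong profile_outer_nbr assms refl)
  also have "\<dots> = (real Q - real q) * (a * f (graph_dist E x r))"
    using card_nbrs_Diff_S[OF assms] by simp
  finally show ?thesis .
qed

lemma sum_nbrs_root:
  "(\<Sum>y\<in>nbrs r. profile a f y) = real q * f 1 + (real Q - real q) * (a * f 0)"
proof -
  have "graph_dist E y r = 1" if "y \<in> nbrs r \<inter> S" for y
    using that graph_dist_adj[of y r r] adj_sym[of y r] adj_neq[of r y] graph_dist_eq_0_iff[of y r]
    by (auto simp: graph_dist_refl)
  then have "(\<Sum>y\<in>nbrs r \<inter> S. f (graph_dist E y r)) = (\<Sum>y\<in>nbrs r \<inter> S. f 1)"
    by (intro sum.cong) auto
  also have "\<dots> = real q * f 1" using card_nbrs_Int_S[OF root] by simp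
  finally show ?thesis using sum_nbrs_in_S[OF root, of a f] by (simp add: graph_dist_refl)
qed

lemma sum_nbrs_S:
  assumes x: "x \<in> S" and k: "graph_dist E x r = Suc k"
  shows "(\<Sum>y\<in>nbrs x. profile a f y) =
    f k + (real q - 1) * f (Suc (Suc k)) + (real Q - real q) * (a * f (Suc k))"
proof -
  have xr: "x \<noteq> r" using k by (auto simp: graph_dist_refl)
  obtain p where p: "adj x p" "graph_dist E x r = Suc (graph_dist E p r)"
    and far: "\<And>y. adj x y \<Longrightarrow> y \<noteq> p \<Longrightarrow> graph_dist E y r = Suc (graph_dist E x r)"
    using parent[OF convex_singleton, of x r] xr by (auto simp: dist_to_set_singleton)
  have p_in: "p \<in> nbrs x \<inter> S" using parent_in_S[OF x xr p] p by blast
  have "(\<Sum>y\<in>nbrs x \<inter> S. f (graph_dist E y r)) =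
      f (graph_dist E p r) + (\<Sum>y\<in>nbrs x \<inter> S - {p}. f (graph_dist E y r))"
    by (rule sum.remove[OF _ p_in]) (simp add: finite_nbrs)
  also have "(\<Sum>y\<in>nbrs x \<inter> S - {p}. f (graph_dist E y r)) =
      (\<Sum>y\<in>nbrs x \<inter> S - {p}. f (Suc (Suc k)))"
    using far k by (intro sum.cong) auto
  also have "\<dots> = (real q - 1) * f (Suc (Suc k))"
  proof -
    have "card (nbrs x \<inter> S) > 0" using p_in finite_nbrs[of x] by (auto simp: card_gt_0_iff)
    then show ?thesis
      using p_in card_nbrs_Int_S[OF x] by (simp add: card_Diff_singleton of_nat_diff)
  qed
  finally show ?thesis using sum_nbrs_in_S[OF x, of a f] k p(2) by simp
qed

text \<open>The parent carries \<open>1 / a\<close> times and each of the \<open>Q - 1\<close> other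
  neighbours \<open>a\<close> times the value at \<open>x\<close>, whatever \<open>f\<close>
  is.\<close>

lemma sum_nbrs_outside:
  assumes x: "x \<notin> S" and a: "a > 0"
  shows "(\<Sum>y\<in>nbrs x. profile a f y) = (1 / a + (real Q - 1) * a) * profile a f x"
proof -
  obtain p where p: "adj x p" "dist_to_set E x S = Suc (dist_to_set E p S)"
    and far: "\<And>y. adj x y \<Longrightarrow> y \<noteq> p \<Longrightarrow> dist_to_set E y S = Suc (dist_to_set E x S)"
    using parent[OF S_convex x] by metis
  have "(\<Sum>y\<in>nbrs x. profile a f y) = profile a f p + (\<Sum>y\<in>nbrs x - {p}. profile a f y)"
    by (rule sum.remove) (use p finite_nbrs in auto)
  also have "(\<Sum>y\<in>nbrs x - {p}. profile a f y) = (\<Sum>y\<in>nbrs x - {p}. a * profile a f x)"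
    using far adj_sym by (intro sum.cong profile_step) auto
  also have "\<dots> = (real Q - 1) * (a * profile a f x)"
    using p(1) degree by (simp add: card_Diff_singleton card_nbrs of_nat_diff)
  also have "profile a f p = profile a f x / a" using profile_step[OF p] a by simp
  finally show ?thesis by (simp add: algebra_simps)
qed

end

section \<open>The secular equation\<close>

text \<open>Parametrizing eigenvalues by the decay ratio removes the square roots;
  \<open>decay_a\<close> is the inverse for ratios below \<open>1 / sqrt (Q - 1)\<close>.\<close>

definition eig :: "nat \<Rightarrow> real \<Rightarrow> real" where
  "eig Q a = 1 / a + (real Q - 1) * a"

lemma eig_gt:
  assumes "Q > 1" "a > 0" "sqrt (real Q - 1) * a < 1"
  shows "eig Q a > 2 * sqrt (real Q - 1)"
proof -
  define m where "m = sqrt (real Q - 1)"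
  have m: "real Q - 1 = m\<^sup>2" using assms(1) by (simp add: m_def)
  have "0 < (1 - m * a)\<^sup>2 / a" using assms(2,3) by (simp add: m_def)
  also have "\<dots> = eig Q a - 2 * m"
    using assms(2) by (simp add: eig_def m field_simps power2_eq_square)
  finally show ?thesis by (simp add: m_def)
qed

text \<open>The radicand becomes a perfect square, and the upper bound on \<open>a\<close> selects
  its nonnegative root.\<close>

lemma eig_discriminant:
  assumes "Q > 1" "a > 0" "sqrt (real Q - 1) * a < 1"
  shows "sqrt (1 - 4 * (real Q - 1) / (eig Q a)\<^sup>2) = (1 / a - (real Q - 1) * a) / eig Q a"
proof (rule real_sqrt_unique)
  have pos: "eig Q a > 0" using assms by (simp add: eig_def add_pos_pos)
  have "(eig Q a)\<^sup>2 - 4 * (real Q - 1) = (1 / a - (real Q - 1) * a)\<^sup>2"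
    using assms(2) by (simp add: eig_def field_simps power2_eq_square)
  then show "((1 / a - (real Q - 1) * a) / eig Q a)\<^sup>2 = 1 - 4 * (real Q - 1) / (eig Q a)\<^sup>2"
    using pos by (simp add: power_divide field_simps)
  have "(sqrt (real Q - 1) * a)\<^sup>2 \<le> 1"
    using assms by (intro power_le_one) auto
  then have "(real Q - 1) * a \<le> 1 / a"
    using assms by (simp add: power_mult_distrib field_simps power2_eq_square)
  then show "0 \<le> (1 / a - (real Q - 1) * a) / eig Q a" using pos by simp
qed

lemma decay_a_eig:
  assumes "Q > 1" "a > 0" "sqrt (real Q - 1) * a < 1"
  shows "decay_a Q (eig Q a) = a"
proof -
  define m where "m = real Q - 1"
  have m: "m > 0" using assms(1) by (simp add: m_def)
  have pos: "eig Q a > 0" using assms by (simp add: eig_def add_pos_pos)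
  have "1 - (1 / a - m * a) / eig Q a = 2 * m * a / eig Q a"
    using pos by (simp add: field_simps) (simp add: eig_def m_def field_simps)
  then show ?thesis
    unfolding decay_a_def eig_discriminant[OF assms] unfolding m_def[symmetric] using pos m by simp
qed

lemma secular_mu_eig:
  assumes "Q > 1" "a > 0" "sqrt (real Q - 1) * a < 1"
  shows "secular_mu Q (eig Q a) = (1 - a\<^sup>2) / a"
proof -
  define m where "m = real Q - 1"
  have m: "m > 0" "real Q = m + 1" "real Q - 2 = m - 1" using assms(1) by (auto simp: m_def)
  have pos: "eig Q a > 0" using assms by (simp add: eig_def add_pos_pos)
  have "secular_mu Q (eig Q a) = ((m - 1) * eig Q a + (m + 1) * (1 / a - m * a)) / (2 * m)"
    unfolding secular_mu_def eig_discriminant[OF assms] unfolding m_def[symmetric]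
    using pos m by (simp add: field_simps)
  also have "\<dots> = (1 - a\<^sup>2) / a"
    using m assms(2) by (simp add: eig_def field_simps power2_eq_square)
  finally show ?thesis .
qed

text \<open>Both sides of the secular equation become multiples of the positive number
  \<open>1 - a\<^sup>2\<close>, which cancels.\<close>

lemma secular_eq_eig:
  assumes "2 < q" "q \<le> Q" and a: "a > 0" "sqrt (real Q - 1) * a < 1"
  shows "secular_eq Q q (eig Q a) \<longleftrightarrow> (1 - sqrt (real q - 1) * a)\<^sup>2 = a"
proof -
  have "1 \<le> sqrt (real Q - 1)" using assms by simp
  then have "a < 1" using a by (smt (verit) mult_le_cancel_right1)
  then have "1 - a\<^sup>2 > 0" using a(1) by (simp add: power_less_one_iff)
  have "sqrt (real q - 1) * a \<le> sqrt (real Q - 1) * a"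
    using assms by (intro mult_right_mono) auto
  then have "sqrt (real q - 1) * a < 1" using a by linarith
  then show ?thesis
    using \<open>1 - a\<^sup>2 > 0\<close> assms decay_a_eig[of Q a] secular_mu_eig[of Q a]
    by (simp add: secular_eq_def mult.commute[of a])
qed

lemma eig_decay_a:
  assumes Q: "Q > 1" and l: "l > 2 * sqrt (real Q - 1)"
  shows "decay_a Q l > 0" "sqrt (real Q - 1) * decay_a Q l < 1" "eig Q (decay_a Q l) = l"
proof -
  define m where "m = sqrt (real Q - 1)"
  have m: "m > 0" "real Q - 1 = m\<^sup>2" using Q by (auto simp: m_def)
  have lm: "2 * m < l" using l by (simp add: m_def)
  have l0: "l > 0" using lm m(1) by linarith
  define d where "d = sqrt (1 - 4 * m\<^sup>2 / l\<^sup>2)"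
  have "(2 * m)\<^sup>2 < l\<^sup>2" using lm m(1) by (intro power_strict_mono) auto
  then have *: "4 * m\<^sup>2 / l\<^sup>2 < 1" using l0 by (simp add: power_mult_distrib)
  then have d2: "d\<^sup>2 = 1 - 4 * m\<^sup>2 / l\<^sup>2" by (simp add: d_def)
  have d: "0 < d" "d < 1" using * m l0 by (auto simp: d_def)
  \<comment> \<open>This factorization expresses the reciprocal of \<open>decay_a\<close> through
    \<open>1 + d\<close>, so that the two summands of \<open>eig\<close> add up to
    \<open>l\<close>.\<close>
  have m2: "4 * m\<^sup>2 = (1 - d) * (1 + d) * l\<^sup>2"
    using d2 l0 by (simp add: field_simps power2_eq_square)
  have a: "decay_a Q l = (1 - d) * l / (2 * m\<^sup>2)"
    using m by (simp add: decay_a_def d_def)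
  have inv: "1 / decay_a Q l = (1 + d) * l / 2"
    using m2 d l0 m(1) by (simp add: a field_simps power2_eq_square)
  show pos: "decay_a Q l > 0" using d l0 m by (simp add: a)
  have ma: "m\<^sup>2 * decay_a Q l = (1 - d) * l / 2" using m by (simp add: a)
  show "eig Q (decay_a Q l) = l"
    unfolding eig_def m(2) inv ma by (simp add: field_simps)
  have "m\<^sup>2 * decay_a Q l < 1 / decay_a Q l" unfolding inv ma using d l0 by simp
  then have "(m * decay_a Q l)\<^sup>2 < 1\<^sup>2" using pos by (simp add: field_simps power2_eq_square)
  then show "sqrt (real Q - 1) * decay_a Q l < 1"
    unfolding m_def[symmetric] by (rule power_less_imp_less_base) simp
qed

text \<open>\<open>(1 - s * a)\<^sup>2\<close> strictly decreases while \<open>s * a < 1\<close>, so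
  it meets the increasing identity at most once.\<close>

lemma critical_decay_unique:
  fixes a b s :: real
  assumes "(1 - s * a)\<^sup>2 = a" "(1 - s * b)\<^sup>2 = b" "s > 0" "s * a < 1" "s * b < 1"
  shows "a = b"
proof (rule ccontr)
  have *: False if "(1 - s * a)\<^sup>2 = a" "(1 - s * b)\<^sup>2 = b" "s * b < 1" "a < b" for a b :: real
  proof -
    have "(1 - s * b)\<^sup>2 < (1 - s * a)\<^sup>2"
      using that assms(3) by (intro power_strict_mono) auto
    then show False using that by simp
  qed
  assume "a \<noteq> b"
  then show False using *[of a b] *[of b a] assms by linarith
qed

text \<open>With \<open>x = sqrt a\<close> the critical equation reads
  \<open>s * x\<^sup>2 + x = 1\<close>; this is the square of its positive root,
  rationalized.\<close>

definition critical_decay :: "nat \<Rightarrow> real" where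
  "critical_decay q = 4 / (1 + sqrt (4 * sqrt (real q - 1) + 1))\<^sup>2"

text \<open>The last equation explains \<open>Q_crit\<close>: \<open>Q - 1 < Q_crit q\<close> says
  that the critical decay lies below \<open>1 / sqrt (Q - 1)\<close>.\<close>

lemma critical_decay:
  assumes "q > 2"
  shows "critical_decay q > 0" "(1 - sqrt (real q - 1) * critical_decay q)\<^sup>2 = critical_decay q"
    "sqrt (real q - 1) * critical_decay q < 1" "Q_crit q = 1 / (critical_decay q)\<^sup>2"
proof -
  define s where "s = sqrt (real q - 1)"
  define z where "z = 1 + sqrt (4 * s + 1)"
  have s0: "s > 0" using assms by (simp add: s_def)
  then have z: "z > 0" by (simp add: z_def add_pos_pos)
  have "(z - 1)\<^sup>2 = 4 * s + 1" using s0 by (simp add: z_def)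
  then have s: "s = (z\<^sup>2 - 2 * z) / 4" by (simp add: power2_diff)
  have a: "critical_decay q = (2 / z)\<^sup>2"
    by (simp add: critical_decay_def power_divide z_def s_def)
  show "critical_decay q > 0" using z by (simp add: a)
  have eq: "1 - s * critical_decay q = 2 / z"
    using z by (simp add: a s field_simps power2_eq_square)
  show "(1 - sqrt (real q - 1) * critical_decay q)\<^sup>2 = critical_decay q"
    by (simp only: s_def[symmetric] eq) (simp only: a)
  have "2 / z > 0" using z by simp
  then show "sqrt (real q - 1) * critical_decay q < 1" using eq unfolding s_def by linarith
  have "Q_crit q = (2 * s + z)\<^sup>2 / 4" by (simp add: Q_crit_def s_def z_def add_ac)
  also have "2 * s + z = z\<^sup>2 / 2" by (simp add: s field_simps)
  finally show "Q_crit q = 1 / (critical_decay q)\<^sup>2"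
    using z by (simp add: a power_divide)
qed

section \<open>Norms and Perron-Frobenius eigenvectors\<close>

context regular_subtree
begin

text \<open>\<open>c\<close> records at which radii the loops sit, so one reduction to radial
  recurrences serves both all of \<open>S\<close> and its balls.\<close>

lemma profile_eigenvector:
  assumes a: "a > 0"
    and f0: "real q * f 1 + ((real Q - real q) * a + of_bool (c 0)) * f 0 = eig Q a * f 0"
    and f: "\<And>k. f k + (real q - 1) * f (Suc (Suc k)) +
      ((real Q - real q) * a + of_bool (c (Suc k))) * f (Suc k) = eig Q a * f (Suc k)"
  shows "loops.act {x \<in> S. c (graph_dist E x r)} (profile a f) x = eig Q a * profile a f x"
proof (cases "x \<in> S")
  case False
  then show ?thesis using sum_nbrs_outside[OF False a] by (simp add: act_loops eig_def)
next
  case True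
  show ?thesis
  proof (cases "graph_dist E x r")
    case 0
    then have "x = r" by (simp add: graph_dist_eq_0_iff)
    then show ?thesis
      using f0 root sum_nbrs_root[of a f]
      by (simp add: act_loops profile_in_S graph_dist_refl algebra_simps)
  next
    case (Suc k)
    then show ?thesis
      using f[of k] True sum_nbrs_S[OF True Suc, of a f]
      by (simp add: act_loops profile_in_S algebra_simps)
  qed
qed

lemma profile_pos:
  "a > 0 \<Longrightarrow> (\<And>k. f k > 0) \<Longrightarrow> profile a f x > 0"
  by (simp add: profile_def)

text \<open>Since \<open>a < 1\<close>, the triangle inequality through the nearest vertex combines
  decay off \<open>S\<close> and along \<open>S\<close> into decay in the distance to
  \<open>r\<close>.\<close>

lemma profile_summable:
  assumes a: "a > 0" "sqrt (real Q - 1) * a < 1"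
    and f: "\<And>k. f k \<ge> 0" "\<And>k. f k \<le> C * a ^ k"
  shows "(\<lambda>x. (profile a f x)\<^sup>2) summable_on UNIV"
proof (rule geometric_square_summable[of a _ C r])
  have "(sqrt (real Q - 1) * a)\<^sup>2 < 1" using a degree by (simp add: power_less_one_iff)
  then show "(real Q - 1) * a\<^sup>2 < 1" using degree by (simp add: power_mult_distrib)
  have "1 \<le> sqrt (real Q - 1)" using degree by simp
  then have "a < 1" using a by (smt (verit) mult_le_cancel_right1)
  fix x
  show "profile a f x \<ge> 0" using a f by (simp add: profile_def)
  define y where "y = nearest_vertex E S x"
  have "C \<ge> 0" using f[of 0] by simp
  have "profile a f x \<le> a ^ dist_to_set E x S * (C * a ^ graph_dist E y r)"
    unfolding profile_def y_def[symmetric] using a f by (intro mult_left_mono) auto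
  also have "\<dots> = C * a ^ (graph_dist E x y + graph_dist E y r)"
    by (simp add: power_add y_def graph_dist_nearest_vertex[OF S_convex])
  also have "\<dots> \<le> C * a ^ graph_dist E x r"
    using \<open>C \<ge> 0\<close> \<open>a < 1\<close> a(1) graph_dist_triangle[of x r y]
    by (intro mult_left_mono power_decreasing) auto
  finally show "profile a f x \<le> C * a ^ graph_dist E x r" .
qed (rule a)

end

section \<open>Norm of the unperturbed tree\<close>

context regular_tree
begin

text \<open>The critical spherical function is a Schur weight for the upper bound. For smaller
  \<open>t\<close>, spherical functions cut off at their first nonpositive value are finitely
  supported subsolutions.\<close>

lemma operator_norm_tree: "operator_norm (adjacency E) = 2 * sqrt (real Q - 1)"
proof -
  obtain r :: 'a where True by simp
  \<comment> \<open>The whole tree as its own subtree makes every \<open>profile\<close> radial; the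
    decay ratio 1 is a placeholder, as no vertex lies outside.\<close>
  interpret full: regular_subtree Q E Q UNIV E r
    by unfold_locales (simp_all add: tree)
  have prof: "full.profile 1 f x = f (graph_dist E x r)" for f x by (simp add: full.profile_in_S)
  have act: "loops.act {} (full.profile 1 f) x = (if graph_dist E x r = 0 then real Q * f 1 else
      f (graph_dist E x r - 1) + (real Q - 1) * f (Suc (graph_dist E x r)))" for f x
    using full.sum_nbrs_root[of 1 f] full.sum_nbrs_S[of x _ 1 f]
    by (cases "graph_dist E x r") (auto simp: act_loops graph_dist_eq_0_iff)
  have rec: "sph Q t k + (real Q - 1) * sph Q t (Suc (Suc k)) = t * sph Q t (Suc k)" for t k
    using degree by (intro sph_recurrence) simp
  define v where "v = full.profile 1 (sph Q (2 * sqrt (real Q - 1)))"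
  have v_pos: "v x > 0" for x
    unfolding v_def prof sph_critical[OF degree] using degree
    by (intro divide_pos_pos add_pos_nonneg) auto
  have v_eig: "loops.act {} v x \<le> 2 * sqrt (real Q - 1) * v x" for x
    using rec[of "2 * sqrt (real Q - 1)"] degree
    by (cases "graph_dist E x r") (simp_all add: v_def act prof del: sph.simps(3))
  have bdd: "bounded_operator (adjacency E)"
    using loops.Schur_bounded[of v "{}", OF v_pos v_eig] by (simp add: add_loops_empty)
  have upper: "operator_norm (adjacency E) \<le> 2 * sqrt (real Q - 1)"
    using loops.Schur_operator_norm_le[of v "{}", OF v_pos v_eig] by (simp add: add_loops_empty)
  have "t \<le> operator_norm (adjacency E)" if t: "0 < t" "t < 2 * sqrt (real Q - 1)" for t
  proof -
    define K where "K = (LEAST k. sph Q t k \<le> 0)"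
    have K: "sph Q t K \<le> 0" and least: "\<And>k. k < K \<Longrightarrow> sph Q t k > 0"
      using LeastI_ex[OF sph_oscillates[OF degree t(2)]] not_less_Least[of _ "\<lambda>k. sph Q t k \<le> 0"]
      by (auto simp: K_def not_le)
    have K0: "K > 1"
    proof (rule ccontr)
      assume "\<not> K > 1"
      then have "K = 0 \<or> K = Suc 0" by auto
      then show False using K t degree by (auto simp: divide_le_0_iff)
    qed
    define f where "f = (\<lambda>k. if k < K then sph Q t k else 0)"
    have f0: "f k \<ge> 0" for k using less_imp_le[OF least[of k]] by (simp add: f_def)
    \<comment> \<open>At \<open>K\<close> itself a nonpositive value is replaced by 0, so the bound
      includes the endpoint, which the recurrence at \<open>K - 1\<close> needs.\<close>
    have f_ge: "f k \<ge> sph Q t k" if "k \<le> K" for k using that K by (auto simp: f_def)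
    define u where "u = full.profile 1 f"
    have sub: "t * u x \<le> loops.act {} u x" for x
    proof (cases "graph_dist E x r")
      case 0
      have "t * f 0 = real Q * f 1" using K0 degree by (simp add: f_def)
      then show ?thesis using 0 by (simp add: u_def act prof)
    next
      case (Suc k)
      have "t * f (Suc k) \<le> f k + (real Q - 1) * f (Suc (Suc k))"
      proof (cases "Suc k < K")
        case True
        have "t * f (Suc k) = sph Q t k + (real Q - 1) * sph Q t (Suc (Suc k))"
          using True rec by (simp add: f_def)
        also have "\<dots> \<le> f k + (real Q - 1) * f (Suc (Suc k))"
          using True degree by (intro add_mono mult_left_mono f_ge) auto
        finally show ?thesis .
      next
        case False
        then show ?thesis using f0[of k] f0[of "Suc (Suc k)"] degree by (simp add: f_def)
      qed
      then show ?thesis using Suc by (simp add: u_def act prof)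
    qed
    have "(\<lambda>x. (u x)\<^sup>2) summable_on UNIV"
    proof (rule summable_on_cong_neutral[THEN iffD1])
      show "(\<lambda>x. (u x)\<^sup>2) summable_on (\<Union>k<K. level r k)"
        using finite_level by (intro summable_on_finite) auto
    qed (auto simp: u_def prof f_def level_def)
    moreover have "u r \<noteq> 0" using K0 by (simp add: u_def prof graph_dist_refl f_def)
    moreover have "u x \<ge> 0" for x using f0 by (simp add: u_def prof)
    ultimately show ?thesis
      using loops.operator_norm_ge[of "{}" t u r] bdd t sub by (simp add: add_loops_empty)
  qed
  moreover have "0 < real Q - 1" using degree by simp
  then have "0 < 2 * sqrt (real Q - 1)" by simp
  ultimately have "2 * sqrt (real Q - 1) \<le> operator_norm (adjacency E)"
    by (blast intro: dense_le_bounded)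
  with upper show ?thesis by simp
qed

end

section \<open>Perturbed trees in the subcritical range\<close>

locale subcritical = regular_subtree +
  assumes q_gt: "2 < q" and q_le: "q \<le> Q"
    and subcritical: "sqrt (real Q - 1) * critical_decay q < 1"
begin

abbreviation \<alpha> :: real where "\<alpha> \<equiv> critical_decay q"

abbreviation s :: real where "s \<equiv> sqrt (real q - 1)"

lemma eig_theta: "eig Q a = theta q a + (real Q - real q) * a + 1"
  by (simp add: eig_def theta_def algebra_simps)

lemma theta_critical: "theta q \<alpha> = 2 * s"
  using critical_decay[OF q_gt] q_gt by (simp add: theta_eq)

definition pf_limit :: "'a \<Rightarrow> real" where "pf_limit = profile \<alpha> (sph q (2 * s))"

lemma pf_limit_pos: "pf_limit x > 0"
  unfolding pf_limit_def sph_critical[OF q_gt, abs_def] using q_gt critical_decay(1)[OF q_gt]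
  by (intro profile_pos divide_pos_pos add_pos_nonneg) auto

lemma pf_limit_eigenvector: "loops.act S pf_limit x = eig Q \<alpha> * pf_limit x"
proof -
  have "loops.act {x \<in> S. True} pf_limit x = eig Q \<alpha> * pf_limit x"
    unfolding pf_limit_def
  proof (rule profile_eigenvector[where c = "\<lambda>_. True"])
    fix k
    show "sph q (2 * s) k + (real q - 1) * sph q (2 * s) (Suc (Suc k)) +
        ((real Q - real q) * \<alpha> + of_bool True) * sph q (2 * s) (Suc k) =
        eig Q \<alpha> * sph q (2 * s) (Suc k)"
      using q_gt unfolding eig_theta theta_critical
      by (subst sph_recurrence) (simp_all add: algebra_simps del: sph.simps)
  qed (use critical_decay(1)[OF q_gt] q_gt in \<open>simp_all add: eig_theta theta_critical algebra_simps\<close>)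
  then show ?thesis by simp
qed

text \<open>Ratios for which the spherical function on the looped ball of radius \<open>n\<close>
  can be glued to a geometric tail.\<close>

definition good :: "nat \<Rightarrow> real \<Rightarrow> bool" where
  "good n a \<longleftrightarrow> 0 < a \<and> sqrt (real Q - 1) * a < 1 \<and>
    sph q (theta q a) (Suc n) = a * sph q (theta q a) n \<and>
    (\<forall>k\<le>Suc n. sph q (theta q a) k > 0)"

lemma good_exists:
  assumes \<beta>: "\<alpha> < \<beta>" "sqrt (real Q - 1) * \<beta> < 1"
  shows "\<forall>\<^sub>F n in sequentially. \<exists>a. \<alpha> < a \<and> a \<le> \<beta> \<and> good n a"
proof -
  have "s * \<beta> \<le> sqrt (real Q - 1) * \<beta>"
    using q_le \<beta>(1) critical_decay(1)[OF q_gt] by (intro mult_right_mono) auto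
  then have "\<beta> * s \<le> 1" using \<beta>(2) by (simp add: mult.commute)
  from matching_decay_exists[OF q_gt critical_decay(1,2)[OF q_gt] \<beta>(1) this]
  show ?thesis
  proof eventually_elim
    case (elim n)
    then obtain a where a: "\<alpha> < a" "a \<le> \<beta>"
      "sph q (theta q a) (Suc n) = a * sph q (theta q a) n"
      "\<forall>k\<le>Suc n. sph q (theta q a) k > 0" by blast
    have "sqrt (real Q - 1) * a \<le> sqrt (real Q - 1) * \<beta>"
      using a degree by (intro mult_left_mono) auto
    then have "sqrt (real Q - 1) * a < 1" using \<beta>(2) by linarith
    moreover have "0 < a" using a(1) critical_decay(1)[OF q_gt] by linarith
    ultimately show ?case using a unfolding good_def by blast
  qed
qed

text \<open>The spherical part extends one radius past the loops because the recurrence at radius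
  \<open>n\<close> involves the value at \<open>Suc n\<close>.\<close>

definition ball_profile :: "nat \<Rightarrow> real \<Rightarrow> nat \<Rightarrow> real" where
  "ball_profile n a k = (if k \<le> Suc n then sph q (theta q a) k else
    sph q (theta q a) (Suc n) * a ^ (k - Suc n))"

definition pf_ball :: "nat \<Rightarrow> real \<Rightarrow> 'a \<Rightarrow> real" where "pf_ball n a = profile a (ball_profile n a)"

abbreviation T :: "nat \<Rightarrow> 'a set" where "T n \<equiv> {x \<in> S. graph_dist E x r \<le> n}"

lemma ball_profile_pos: "good n a \<Longrightarrow> ball_profile n a k > 0"
  by (simp add: ball_profile_def good_def)

lemma pf_ball_pos: "good n a \<Longrightarrow> pf_ball n a x > 0"
  unfolding pf_ball_def by (rule profile_pos) (simp_all add: ball_profile_pos good_def[of n a])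

lemma pf_ball_root: "pf_ball n a r = 1"
  by (simp add: pf_ball_def profile_in_S[OF root] graph_dist_refl ball_profile_def)

lemma ball_profile_ball: "k \<le> Suc n \<Longrightarrow> ball_profile n a k = sph q (theta q a) k"
  by (simp add: ball_profile_def)

lemma ball_profile_tail:
  assumes "good n a" "n \<le> k"
  shows "ball_profile n a (Suc k) = a * ball_profile n a k"
proof (cases "k = n")
  case True
  then show ?thesis using assms by (simp add: ball_profile_def good_def)
next
  case False
  have tail: "ball_profile n a j = sph q (theta q a) (Suc n) * a ^ (j - Suc n)" if "Suc n \<le> j" for j
    using that by (cases "j = Suc n") (auto simp: ball_profile_def)
  have "Suc k - Suc n = Suc (k - Suc n)" "Suc n \<le> k" using assms False by auto
  then show ?thesis using tail[of k] tail[of "Suc k"] by simp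
qed

lemma pf_ball_eigenvector:
  assumes g: "good n a"
  shows "loops.act (T n) (pf_ball n a) x = eig Q a * pf_ball n a x"
  unfolding pf_ball_def
proof (rule profile_eigenvector[where c = "\<lambda>k. k \<le> n"])
  show "a > 0" using g by (simp add: good_def)
  have "real q * ball_profile n a 1 = theta q a * ball_profile n a 0"
    using q_gt by (simp add: ball_profile_ball)
  then show "real q * ball_profile n a 1 + ((real Q - real q) * a + of_bool (0 \<le> n)) * ball_profile n a 0 =
      eig Q a * ball_profile n a 0"
    by (simp add: eig_theta algebra_simps)
  fix k
  show "ball_profile n a k + (real q - 1) * ball_profile n a (Suc (Suc k)) +
      ((real Q - real q) * a + of_bool (Suc k \<le> n)) * ball_profile n a (Suc k) =
      eig Q a * ball_profile n a (Suc k)"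
  proof (cases "Suc k \<le> n")
    case True
    then have "ball_profile n a k + (real q - 1) * ball_profile n a (Suc (Suc k)) = theta q a * ball_profile n a (Suc k)"
      using q_gt by (simp add: ball_profile_ball)
    then show ?thesis using True by (simp add: eig_theta algebra_simps)
  next
    \<comment> \<open>Past the loops, from radius \<open>Suc n\<close> on, three consecutive values
      are geometric and the equation reduces to the definition of \<open>eig\<close>.\<close>
    case False
    then have "ball_profile n a (Suc k) = a * ball_profile n a k"
      "ball_profile n a (Suc (Suc k)) = a * (a * ball_profile n a k)"
      using ball_profile_tail[OF g] by simp_all
    then show ?thesis
      using False \<open>a > 0\<close> by (simp add: eig_def field_simps)
  qed
qed

lemma pf_ball_summable:
  assumes g: "good n a"
  shows "(\<lambda>x. (pf_ball n a x)\<^sup>2) summable_on UNIV"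
  unfolding pf_ball_def
proof (rule profile_summable)
  show a: "a > 0" "sqrt (real Q - 1) * a < 1" using g by (auto simp: good_def)
  show "ball_profile n a k \<ge> 0" for k using ball_profile_pos[OF g] by (simp add: less_imp_le)
  \<comment> \<open>Only finitely many radii precede the tail; the sum dominates each ratio there,
    and the tail inherits the bound at \<open>Suc n\<close>.\<close>
  define C where "C = (\<Sum>k\<le>Suc n. ball_profile n a k / a ^ k)"
  have C: "ball_profile n a k \<le> C * a ^ k" if "k \<le> Suc n" for k
  proof -
    have "ball_profile n a k / a ^ k \<le> C"
      unfolding C_def using that a ball_profile_pos[OF g]
      by (intro member_le_sum) (auto simp: less_imp_le)
    then show ?thesis using a by (simp add: field_simps)
  qed
  show "ball_profile n a k \<le> C * a ^ k" for k
  proof (cases "k \<le> Suc n")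
    case False
    have "ball_profile n a k = ball_profile n a (Suc n) * a ^ (k - Suc n)" using False by (simp add: ball_profile_def)
    also have "\<dots> \<le> (C * a ^ Suc n) * a ^ (k - Suc n)"
      using C[of "Suc n"] a by (intro mult_right_mono) auto
    also have "\<dots> = C * a ^ k" using False by (simp add: mult.assoc power_add[symmetric] del: power_Suc)
    finally show ?thesis .
  qed (rule C)
qed

lemma ball_loops_eq: "ball_loops E S r n = add_loops E (T n)"
  by (simp add: ball_loops_def)

lemma ball_loops_norm: "good n a \<Longrightarrow> operator_norm (adjacency (ball_loops E S r n)) = eig Q a"
  unfolding ball_loops_eq
  by (rule loops.eigenvector_operator_norm[of "pf_ball n a", OF pf_ball_pos pf_ball_eigenvector pf_ball_summable])

lemma ball_loops_perron_frobenius: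
  assumes g: "good n a"
  shows "perron_frobenius (adjacency (ball_loops E S r n)) u \<and> u r = 1 \<longleftrightarrow> u = pf_ball n a"
proof -
  have bdd: "bounded_operator (adjacency (add_loops E (T n)))"
    by (rule loops.Schur_bounded[where l = "eig Q a", of "pf_ball n a", OF pf_ball_pos[OF g]]) (simp add: pf_ball_eigenvector[OF g])
  have norm: "operator_norm (adjacency (add_loops E (T n))) = eig Q a"
    using ball_loops_norm[OF g] by (simp add: ball_loops_eq)
  have "u = pf_ball n a" if "\<forall>x. u x > 0" "\<forall>x. loops.act (T n) u x = eig Q a * u x" "u r = 1"
    using that pf_ball_root
    by (intro loops.positive_eigenvector_unique[where z = r, OF loops_irreducible pf_ball_pos[OF g] pf_ball_eigenvector[OF g]
      pf_ball_summable[OF g]]) auto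
  then show ?thesis
    unfolding ball_loops_eq loops.perron_frobenius_iff[OF bdd] norm
    using pf_ball_pos[OF g] pf_ball_eigenvector[OF g] pf_ball_root by auto
qed

text \<open>The eigenvalue is the operator norm of one fixed matrix, and \<open>decay_a\<close>
  recovers the ratio from it.\<close>

lemma good_unique:
  assumes "good n a" "good n b"
  shows "a = b"
proof -
  have "eig Q a = eig Q b" using ball_loops_norm assms by metis
  moreover have "decay_a Q (eig Q a) = a" "decay_a Q (eig Q b) = b"
    using assms degree by (auto intro!: decay_a_eig simp: good_def)
  ultimately show ?thesis by metis
qed

text \<open>Meaningful only where a good ratio exists, which is the case for large \<open>n\<close>
  by \<open>eventually_good\<close>.\<close>

definition decay_seq :: "nat \<Rightarrow> real" where "decay_seq n = (SOME a. good n a)"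

lemma decay_seq_eq: "good n a \<Longrightarrow> decay_seq n = a"
  unfolding decay_seq_def using good_unique by (metis someI)

lemma supercritical_room: "\<exists>\<beta>. \<alpha> < \<beta> \<and> sqrt (real Q - 1) * \<beta> < 1"
proof -
  have "\<alpha> < 1 / sqrt (real Q - 1)" using subcritical degree by (simp add: field_simps)
  then obtain \<beta> where "\<alpha> < \<beta>" "\<beta> < 1 / sqrt (real Q - 1)" using dense by blast
  then show ?thesis using degree by (intro exI[of _ \<beta>]) (simp add: field_simps)
qed

lemma eventually_good: "\<forall>\<^sub>F n in sequentially. good n (decay_seq n)"
proof -
  obtain \<beta> where "\<alpha> < \<beta>" "sqrt (real Q - 1) * \<beta> < 1" using supercritical_room by blast
  from good_exists[OF this] show ?thesis
    by eventually_elim (use decay_seq_eq in metis)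
qed

text \<open>By uniqueness the ratio that \<open>good_exists\<close> finds just above
  \<open>\<alpha>\<close> is \<open>decay_seq n\<close>, and the upper end \<open>\<beta>\<close>
  can be taken arbitrarily close to \<open>\<alpha>\<close>.\<close>

lemma decay_seq_tendsto: "decay_seq \<longlonglongrightarrow> \<alpha>"
proof (rule order_tendstoI)
  obtain \<gamma> where \<gamma>: "\<alpha> < \<gamma>" "sqrt (real Q - 1) * \<gamma> < 1" using supercritical_room by blast
  show "\<forall>\<^sub>F n in sequentially. b < decay_seq n" if "b < \<alpha>" for b
    using good_exists[OF \<gamma>] by eventually_elim (use decay_seq_eq that in fastforce)
  show "\<forall>\<^sub>F n in sequentially. decay_seq n < b" if b: "\<alpha> < b" for b
  proof -
    obtain \<beta> where \<beta>: "\<alpha> < \<beta>" "\<beta> < min b \<gamma>" using b \<gamma>(1) dense[of \<alpha> "min b \<gamma>"] by auto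
    have "sqrt (real Q - 1) * \<beta> \<le> sqrt (real Q - 1) * \<gamma>"
      using \<beta> degree by (intro mult_left_mono) auto
    then have "sqrt (real Q - 1) * \<beta> < 1" using \<gamma>(2) by linarith
    from good_exists[OF \<beta>(1) this] show ?thesis
      by eventually_elim (use decay_seq_eq \<beta>(2) in fastforce)
  qed
qed

lemma eig_tendsto: "(\<lambda>n. eig Q (decay_seq n)) \<longlonglongrightarrow> eig Q \<alpha>"
  unfolding eig_def using critical_decay(1)[OF q_gt]
  by (intro tendsto_intros decay_seq_tendsto) auto

lemma S_bounded: "bounded_operator (adjacency (add_loops E S))"
  by (rule loops.Schur_bounded[where l = "eig Q \<alpha>", of pf_limit, OF pf_limit_pos]) (simp add: pf_limit_eigenvector)

text \<open>For the lower bound, the loops outside the ball turn each \<open>pf_ball\<close> into a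
  square-summable subsolution for \<open>S\<close>, with eigenvalues tending to
  \<open>eig Q \<alpha>\<close>.\<close>

lemma S_operator_norm: "operator_norm (adjacency (add_loops E S)) = eig Q \<alpha>"
proof (rule antisym)
  show "operator_norm (adjacency (add_loops E S)) \<le> eig Q \<alpha>"
    by (rule loops.Schur_operator_norm_le[of pf_limit, OF pf_limit_pos]) (simp add: pf_limit_eigenvector)
  have "\<forall>\<^sub>F n in sequentially. eig Q (decay_seq n) \<le> operator_norm (adjacency (add_loops E S))"
    using eventually_good
  proof eventually_elim
    case (elim n)
    define a where "a = decay_seq n"
    have g: "good n a" using elim by (simp add: a_def)
    have "loops.act (T n) (pf_ball n a) x \<le> loops.act S (pf_ball n a) x" for x
      using pf_ball_pos[OF g] by (auto simp: act_loops less_imp_le)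
    then have sub: "eig Q a * pf_ball n a x \<le> loops.act S (pf_ball n a) x" for x
      by (simp add: pf_ball_eigenvector[OF g])
    have "eig Q a \<ge> 0" using g degree by (simp add: good_def eig_def)
    then show ?case
      unfolding a_def[symmetric]
      using pf_ball_pos[OF g] pf_ball_root[of n a] pf_ball_summable[OF g] sub
      by (intro loops.operator_norm_ge[OF S_bounded, of _ "pf_ball n a" r]) (auto simp: less_imp_le)
  qed
  then show "eig Q \<alpha> \<le> operator_norm (adjacency (add_loops E S))"
    using eig_tendsto tendsto_upperbound trivial_limit_sequentially by blast
qed

lemma pf_ball_tendsto: "(\<lambda>n. pf_ball n (decay_seq n) x) \<longlonglongrightarrow> pf_limit x"
proof -
  define k where "k = graph_dist E (nearest_vertex E S x) r"
  define d where "d = dist_to_set E x S"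
  have "continuous_on {0<..} (\<lambda>a. a ^ d * sph q (theta q a) k)"
    by (intro continuous_intros) auto
  then have "isCont (\<lambda>a. a ^ d * sph q (theta q a) k) \<alpha>"
    using critical_decay(1)[OF q_gt] by (simp add: continuous_on_eq_continuous_at)
  then have "(\<lambda>n. decay_seq n ^ d * sph q (theta q (decay_seq n)) k) \<longlonglongrightarrow> pf_limit x"
    using isCont_tendsto_compose[OF _ decay_seq_tendsto]
    by (fastforce simp: pf_limit_def profile_def k_def d_def theta_critical)
  \<comment> \<open>For a fixed vertex the nearest point lies in the ball once \<open>n\<close> is
    at least \<open>k\<close>, so only the spherical branch matters.\<close>
  moreover have "\<forall>\<^sub>F n in sequentially. decay_seq n ^ d * sph q (theta q (decay_seq n)) k =
      pf_ball n (decay_seq n) x"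
    using eventually_ge_at_top[of k]
    by eventually_elim (simp add: pf_ball_def profile_def ball_profile_ball k_def d_def)
  ultimately show ?thesis by (rule Lim_transform_eventually)
qed

end

theorem theorem6p3:
  fixes q Q :: nat
    and E F :: "'a set set" and S :: "'a set" and r :: 'a
    and lam :: real and v :: "'a \<Rightarrow> real"
  assumes "q > 2" and "q \<le> Q" and "int Q \<le> \<lfloor>Q_crit q\<rfloor> + 1"
    and not_borderline: "real Q \<noteq> Q_crit q + 1"
    and tree: "homogeneous_tree Q UNIV E"
    and subtree: "homogeneous_tree q S F" "F \<subseteq> E"
    and root: "r \<in> S"
    and lam: "lam = operator_norm (adjacency (add_loops E S))"
    and v: "\<And>x. v x = decay_a Q lam ^ dist_to_set E x S * phi_half q E r (nearest_vertex E S x)"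
  shows "operator_norm (adjacency E) = 2 * sqrt (real Q - 1) \<and>
    (lam > 2 * sqrt (real Q - 1) \<and> secular_eq Q q lam \<and>
      (\<forall>l > 2 * sqrt (real Q - 1). secular_eq Q q l \<longrightarrow> l = lam)) \<and>
    (\<forall>x. \<exists>!y. y \<in> S \<and> graph_dist E x y = dist_to_set E x S) \<and>
    perron_frobenius (adjacency (add_loops E S)) v \<and>
    (\<forall>\<^sub>F n in sequentially.
      \<exists>!u. perron_frobenius (adjacency (ball_loops E S r n)) u \<and> u r = 1) \<and>
    (\<forall>vn :: nat \<Rightarrow> 'a \<Rightarrow> real.
      (\<forall>\<^sub>F n in sequentially.
        perron_frobenius (adjacency (ball_loops E S r n)) (vn n) \<and> vn n r = 1) \<longrightarrow>
      (\<forall>x. (\<lambda>n. vn n x) \<longlonglongrightarrow> v x))"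
proof -
  define \<alpha> where "\<alpha> = critical_decay q"
  note \<alpha> = critical_decay[OF \<open>q > 2\<close>, folded \<alpha>_def]
  have subcrit: "sqrt (real Q - 1) * \<alpha> < 1"
  proof -
    \<comment> \<open>The floor bound still allows equality when \<open>Q_crit q\<close> is an
      integer; \<open>not_borderline\<close> makes the inequality strict.\<close>
    have "real Q \<le> Q_crit q + 1" using assms(3) by linarith
    then have "real Q - 1 < 1 / \<alpha>\<^sup>2" using not_borderline \<alpha>(4) by simp
    then have "(sqrt (real Q - 1) * \<alpha>)\<^sup>2 < 1\<^sup>2"
      using \<alpha>(1) assms(1,2) by (simp add: field_simps)
    then show ?thesis by (rule power_less_imp_less_base) simp
  qed
  interpret subcritical Q E q S F r
    using assms subcrit by unfold_locales (auto simp: \<alpha>_def)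
  have lam_eq: "lam = eig Q \<alpha>" using lam S_operator_norm by (simp add: \<alpha>_def)
  have Q: "Q > 1" using degree by simp
  have decay: "decay_a Q lam = \<alpha>" unfolding lam_eq by (rule decay_a_eig[OF Q \<alpha>(1) subcrit])
  have "(real q - 1) powr (- (real k / 2)) = 1 / sqrt (real q - 1) ^ k" for k
    using \<open>q > 2\<close>
    by (simp add: powr_minus powr_half_sqrt_powr powr_realpow real_sqrt_power inverse_eq_divide)
  then have v_eq: "v = pf_limit"
    by (simp add: fun_eq_iff v decay pf_limit_def profile_def phi_half_def sph_critical[OF \<open>q > 2\<close>]
      \<alpha>_def[symmetric])
  show ?thesis
  proof (intro conjI allI impI)
    show "operator_norm (adjacency E) = 2 * sqrt (real Q - 1)" by (rule operator_norm_tree)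
    show "lam > 2 * sqrt (real Q - 1)" unfolding lam_eq by (rule eig_gt[OF Q \<alpha>(1) subcrit])
    show "secular_eq Q q lam"
      unfolding lam_eq secular_eq_eig[OF assms(1,2) \<alpha>(1) subcrit] by (rule \<alpha>(2))
    \<comment> \<open>Any solution \<open>l\<close> is \<open>eig\<close> of its own decay ratio,
      which then satisfies the critical equation and equals \<open>\<alpha>\<close>.\<close>
    show "l = lam" if l: "2 * sqrt (real Q - 1) < l" "secular_eq Q q l" for l
    proof -
      note d = eig_decay_a[OF Q l(1)]
      have eq: "(1 - sqrt (real q - 1) * decay_a Q l)\<^sup>2 = decay_a Q l"
        using l(2) secular_eq_eig[OF assms(1,2) d(1,2)] d(3) by simp
      have "sqrt (real q - 1) * decay_a Q l \<le> sqrt (real Q - 1) * decay_a Q l"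
        using d(1) assms(2) by (intro mult_right_mono) auto
      then have "decay_a Q l = \<alpha>"
        using critical_decay_unique[OF eq \<alpha>(2)] \<alpha>(3) d(2) \<open>q > 2\<close> by simp
      then show ?thesis using d(3) lam_eq by simp
    qed
    show "\<exists>!y. y \<in> S \<and> graph_dist E x y = dist_to_set E x S" for x
      by (rule nearest_exists_unique[OF S_convex])
    show "perron_frobenius (adjacency (add_loops E S)) v"
      unfolding loops.perron_frobenius_iff[OF S_bounded] S_operator_norm v_eq
      using pf_limit_pos pf_limit_eigenvector by blast
    show "\<forall>\<^sub>F n in sequentially.
      \<exists>!u. perron_frobenius (adjacency (ball_loops E S r n)) u \<and> u r = 1"
      using eventually_good by eventually_elim (simp add: ball_loops_perron_frobenius)
    show "(\<lambda>n. vn n x) \<longlonglongrightarrow> v x"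
      if vn: "\<forall>\<^sub>F n in sequentially.
        perron_frobenius (adjacency (ball_loops E S r n)) (vn n) \<and> vn n r = 1"
      for vn :: "nat \<Rightarrow> 'a \<Rightarrow> real" and x
    proof (rule Lim_transform_eventually)
      show "(\<lambda>n. pf_ball n (decay_seq n) x) \<longlonglongrightarrow> v x" unfolding v_eq by (rule pf_ball_tendsto)
      show "\<forall>\<^sub>F n in sequentially. pf_ball n (decay_seq n) x = vn n x"
        using eventually_good vn by eventually_elim (simp add: ball_loops_perron_frobenius)
    qed
  qed
qed

end
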